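(* Let $\theta_0=[\mathrm{vec}(A_0)^T,\mu_0^T]^T\in\mathscr{D}(p,r)$ and suppose $M_0=M(\mu_0)$ is nonsingular. Then $$\sigma_{\min}\{D_\varphi\Sigma(\theta_0)\}\ge\begin{cases}\dfrac{2\sqrt2\,\sigma_r(M_0)(1-\|A_0\|_2^2)}{(1+\|A_0\|_2^2)^2},& r\ge2,\\[2mm] \dfrac{2\sqrt2\,\sigma_r(M_0)}{1+\|A_0\|_2^2},& r=1,\end{cases}$$ and $D\Sigma(\theta_0)^TD\Sigma(\theta_0)$ is invertible with $$\|\{D\Sigma(\theta_0)^TD\Sigma(\theta_0)\}^{-1}\|_2\le\begin{cases}1+\dfrac{(1+64\|M_0\|_2^2)(1+\|A_0\|_2^2)^4}{8\lambda_r^2(M_0)(1-\|A_0\|_2^2)^2},& r\ge2,\\[2mm] 1+\dfrac{(1+64\|M_0\|_2^2)(1+\|A_0\|_2^2)^2}{8\lambda_r^2(M_0)},& r=1.\end{cases}$$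
   Context: Fix integers $1\le r\le p$. For $A\in\mathbb{R}^{(p-r)\times r}$ write $\varphi=\mathrm{vec}(A)$ (column-stacking), $X_\varphi=\begin{bmatrix}0_{r\times r}&-A^{T}\\ A&0\end{bmatrix}$, $I_{p\times r}=\begin{bmatrix}I_r\\0\end{bmatrix}$, and let $U(\varphi)=(I_p+X_\varphi)(I_p-X_\varphi)^{-1}I_{p\times r}$ be the Cayley parameterization, with derivative $DU(\varphi)=2[I_{p\times r}^T(I_p-X_\varphi)^{-T}\otimes(I_p-X_\varphi)^{-1}]\Gamma$, $\Gamma=(I_{p^2}-K_{pp})(\Theta_1^T\otimes\Theta_2^T)$, $\Theta_1=I_{p\times r}^T$, $\Theta_2=[0_{(p-r)\times r},I_{p-r}]$; $K_{pq}$ is the commutation matrix ($\mathrm{vec}(M^T)=K_{pq}\mathrm{vec}(M)$). For a symmetric $r\times r$ matrix $M$, $\mathrm{vech}(M)\in\mathbb{R}^{r(r+1)/2}$ stacks the on-and-below-diagonal entries column by column, $M(\mu)$ is the symmetric matrix with $\mathrm{vech}(M(\mu))=\mu$, and $\mathbb{D}_r$ is the duplication matrix ($\mathrm{vec}(M)=\mathbb{D}_r\mathrm{vech}(M)$). Let $\mathscr{D}(p,r)=\{\theta=[\mathrm{vec}(A)^T,\mu^T]^T: A\in\mathbb{R}^{(p-r)\times r},\|A\|_2<1,\ \mu\in\mathbb{R}^{r(r+1)/2}\}$ and $\Sigma(\theta)=U(\varphi)M(\mu)U(\varphi)^T$. Define $D_\varphi\Sigma(\theta)=(I_{p^2}+K_{pp})\{U(\varphi)M(\mu)\otimes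 I_p\}DU(\varphi)$, $D_\mu\Sigma(\theta)=\{U(\varphi)\otimes U(\varphi)\}\mathbb{D}_r$, $D\Sigma(\theta)=[D_\varphi\Sigma(\theta),\,D_\mu\Sigma(\theta)]$. $\sigma_{\min}$ denotes the smallest singular value, $\sigma_r(M_0)$ the smallest singular value of $M_0$, and the eigenvalues of the symmetric $M_0$ are ordered by magnitude $|\lambda_1(M_0)|\ge\dots\ge|\lambda_r(M_0)|$. *)

theory Defs
  imports Complex_Main "Jordan_Normal_Form.Jordan_Normal_Form" "Jordan_Normal_Form.Gauss_Jordan_Elimination"
begin

definition kron :: "real mat \<Rightarrow> real mat \<Rightarrow> real mat" where
  "kron A B = mat (dim_row A * dim_row B) (dim_col A * dim_col B)
     (\<lambda>(i,j). A $$ (i div dim_row B, j div dim_col B) * B $$ (i mod dim_row B, j mod dim_col B))"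

definition vecm :: "real mat \<Rightarrow> real vec" where
  "vecm M = vec (dim_row M * dim_col M) (\<lambda>k. M $$ (k mod dim_row M, k div dim_row M))"

(* commutation matrix K_{mn}: vecm (transpose M) = K_{mn} *v vecm M for M an m x n matrix *)
definition commut :: "nat \<Rightarrow> nat \<Rightarrow> real mat" where
  "commut m n = mat (m*n) (m*n) (\<lambda>(l,k). if k = l div n + (l mod n) * m then 1 else 0)"

(* position (0-based) in vech of the entry (i,j), i \<ge> j, of an r x r matrix *)
definition vech_idx :: "nat \<Rightarrow> nat \<Rightarrow> nat \<Rightarrow> nat" where
  "vech_idx r i j = (\<Sum>c<j. r - c) + (i - j)"

definition vech :: "real mat \<Rightarrow> real vec" where
  "vech M = (let r = dim_row M in
     vec (r*(r+1) div 2) (\<lambda>k. M $$ (THE (i,j). j \<le> i \<and> i < r \<and> vech_idx r i j = k)))"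

(* M(mu): the symmetric r x r matrix with vech (M mu) = mu *)
definition sym_of :: "nat \<Rightarrow> real vec \<Rightarrow> real mat" where
  "sym_of r \<mu> = mat r r (\<lambda>(i,j). \<mu> $ vech_idx r (max i j) (min i j))"

(* duplication matrix: vecm M = dup r *v vech M for symmetric r x r M *)
definition dup :: "nat \<Rightarrow> real mat" where
  "dup r = mat (r*r) (r*(r+1) div 2)
     (\<lambda>(k,l). if l = vech_idx r (max (k mod r) (k div r)) (min (k mod r) (k div r)) then 1 else 0)"

definition minv :: "real mat \<Rightarrow> real mat" where
  "minv M = the (mat_inverse M)"

definition Ipr :: "nat \<Rightarrow> nat \<Rightarrow> real mat" where
  "Ipr p r = mat p r (\<lambda>(i,j). if i = j then 1 else 0)"

(* X_phi for phi = vec(A), A a (p-r) x r matrix *)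
definition Xmat :: "nat \<Rightarrow> nat \<Rightarrow> real mat \<Rightarrow> real mat" where
  "Xmat p r A = four_block_mat (0\<^sub>m r r) (- transpose_mat A) A (0\<^sub>m (p-r) (p-r))"

definition Ucay :: "nat \<Rightarrow> nat \<Rightarrow> real mat \<Rightarrow> real mat" where
  "Ucay p r A = (1\<^sub>m p + Xmat p r A) * minv (1\<^sub>m p - Xmat p r A) * Ipr p r"

definition Theta1 :: "nat \<Rightarrow> nat \<Rightarrow> real mat" where
  "Theta1 p r = transpose_mat (Ipr p r)"

definition Theta2 :: "nat \<Rightarrow> nat \<Rightarrow> real mat" where
  "Theta2 p r = four_block_mat (0\<^sub>m (p-r) r) (1\<^sub>m (p-r)) (0\<^sub>m 0 r) (0\<^sub>m 0 (p-r))"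

definition Gam :: "nat \<Rightarrow> nat \<Rightarrow> real mat" where
  "Gam p r = (1\<^sub>m (p*p) - commut p p) *
      kron (transpose_mat (Theta1 p r)) (transpose_mat (Theta2 p r))"

definition DU :: "nat \<Rightarrow> nat \<Rightarrow> real mat \<Rightarrow> real mat" where
  "DU p r A = 2 \<cdot>\<^sub>m (kron (transpose_mat (Ipr p r) * transpose_mat (minv (1\<^sub>m p - Xmat p r A)))
                          (minv (1\<^sub>m p - Xmat p r A)) * Gam p r)"

definition DphiSigma :: "nat \<Rightarrow> nat \<Rightarrow> real mat \<Rightarrow> real vec \<Rightarrow> real mat" where
  "DphiSigma p r A \<mu> = (1\<^sub>m (p*p) + commut p p) *
      kron (Ucay p r A * sym_of r \<mu>) (1\<^sub>m p) * DU p r A"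

definition DmuSigma :: "nat \<Rightarrow> nat \<Rightarrow> real mat \<Rightarrow> real mat" where
  "DmuSigma p r A = kron (Ucay p r A) (Ucay p r A) * dup r"

definition hcat :: "real mat \<Rightarrow> real mat \<Rightarrow> real mat" where
  "hcat A B = mat (dim_row A) (dim_col A + dim_col B)
     (\<lambda>(i,j). if j < dim_col A then A $$ (i,j) else B $$ (i, j - dim_col A))"

definition DSigma :: "nat \<Rightarrow> nat \<Rightarrow> real mat \<Rightarrow> real vec \<Rightarrow> real mat" where
  "DSigma p r A \<mu> = hcat (DphiSigma p r A \<mu>) (DmuSigma p r A)"

definition sigma_min :: "real mat \<Rightarrow> real" where
  "sigma_min M = sqrt (Min {l. eigenvalue (transpose_mat M * M) l})"

definition spec_norm :: "real mat \<Rightarrow> real" where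
  "spec_norm M = sqrt (Max {l. eigenvalue (transpose_mat M * M) l})"

definition eig_min_abs :: "real mat \<Rightarrow> real" where
  "eig_min_abs M = Min {\<bar>l\<bar> | l. eigenvalue M l}"

end

theory Submission
  imports Defs "HOL-Analysis.L2_Norm" "HOL-Analysis.Function_Topology"
    "Jordan_Normal_Form.Spectral_Radius"
begin

text \<open>
  Write \<open>X\<close> for the skew matrix of \<open>A\<^sub>0\<close>, \<open>C = (I - X)\<^sup>-\<^sup>1\<close> and \<open>Q = (I + X) C\<close>, which is orthogonal, so that
  \<open>U = Q I\<^sub>p\<^sub>r\<close>. Then \<open>D\<Sigma>(B, N) = Q Z Q\<^sup>T\<close> for a block matrix \<open>Z\<close> whose diagonal blocks are
  \<open>2 V M + 2 M V\<^sup>T + N\<close> and \<open>0\<close> and whose lower left block is \<open>2 W M\<close> (the upper right one being its transpose),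
  where \<open>V\<close> and \<open>W\<close> form the first block column of \<open>C\<^sup>T X\<^sub>B C\<close>. Writing \<open>C\<close> with
  \<open>S = (I + A\<^sup>T A)\<^sup>-\<^sup>1\<close> and \<open>T = (I + A A\<^sup>T)\<^sup>-\<^sup>1\<close> gives \<open>V = S (A\<^sup>T B - B\<^sup>T A) S\<close> and
  \<open>W = T (B + A B\<^sup>T A) S\<close>, whence \<open>\<parallel>V\<parallel> \<le> 2 \<parallel>B\<parallel>\<close> and a lower bound for \<open>\<parallel>W\<parallel>\<close> in terms of
  \<open>\<parallel>B\<parallel>\<close>. The off-diagonal blocks control \<open>B\<close>, and then the leading block controls \<open>N\<close>.
  The eigenvalue characterization of the singular values comes from minimizing the quadratic form on
  the compact unit sphere.
\<close>

section \<open>Euclidean and Frobenius norms\<close>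

text \<open>Routed through \<open>L2_set\<close> so that the Cauchy-Schwarz and Minkowski
  inequalities available there carry over to vectors of this type.\<close>

definition vnorm :: "real vec \<Rightarrow> real" where
  "vnorm v = L2_set (\<lambda>i. v $ i) {..<dim_vec v}"

text \<open>The Frobenius norm. Going through \<open>vecm\<close> makes the Euclidean norm of a
  vectorized derivative literally a matrix norm.\<close>

definition fnorm :: "real mat \<Rightarrow> real" where
  "fnorm M = vnorm (vecm M)"

lemma vnorm_nonneg [simp]: "0 \<le> vnorm v"
  by (simp add: vnorm_def)

lemma vnorm_sq: "(vnorm v)\<^sup>2 = v \<bullet> v"
  by (simp add: vnorm_def L2_set_def sum_nonneg scalar_prod_def power2_eq_square atLeast0LessThan)

lemma vnorm_eq_0_iff: "v \<in> carrier_vec n \<Longrightarrow> vnorm v = 0 \<longleftrightarrow> v = 0\<^sub>v n"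
  by (auto simp: vnorm_def L2_set_eq_0_iff intro!: eq_vecI)

lemma scalar_prod_le_vnorm:
  assumes "v \<in> carrier_vec n" "w \<in> carrier_vec n"
  shows "v \<bullet> w \<le> vnorm v * vnorm w"
proof -
  have "v \<bullet> w \<le> (\<Sum>i<n. \<bar>v $ i\<bar> * \<bar>w $ i\<bar>)"
    using assms by (auto simp: scalar_prod_def atLeast0LessThan abs_mult[symmetric] intro!: sum_mono)
  also have "\<dots> \<le> vnorm v * vnorm w"
    using L2_set_mult_ineq[of "\<lambda>i. v $ i" "\<lambda>i. w $ i" "{..<n}"] assms by (simp add: vnorm_def)
  finally show ?thesis .
qed

lemma vnorm_triangle:
  assumes "v \<in> carrier_vec n" "w \<in> carrier_vec n"
  shows "vnorm (v + w) \<le> vnorm v + vnorm w"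
proof -
  have "vnorm (v + w) = L2_set (\<lambda>i. v $ i + w $ i) {..<n}"
    using assms by (auto simp: vnorm_def intro!: L2_set_cong)
  then show ?thesis
    using L2_set_triangle_ineq[of "\<lambda>i. v $ i" "\<lambda>i. w $ i" "{..<n}"] assms by (simp add: vnorm_def)
qed

lemma vnorm_smult: "vnorm (c \<cdot>\<^sub>v v) = \<bar>c\<bar> * vnorm v"
proof -
  have "vnorm (c \<cdot>\<^sub>v v) = L2_set (\<lambda>i. c * v $ i) {..<dim_vec v}"
    by (auto simp: vnorm_def intro!: L2_set_cong)
  then show ?thesis
    by (simp add: vnorm_def L2_set_def power_mult_distrib sum_distrib_left[symmetric] real_sqrt_mult)
qed

lemma vnorm_append_sq: "(vnorm (v @\<^sub>v w))\<^sup>2 = (vnorm v)\<^sup>2 + (vnorm w)\<^sup>2"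
  unfolding vnorm_sq by (rule scalar_prod_append[of _ "dim_vec v" _ "dim_vec w"]) auto

lemma vec_idx_bounds:
  fixes k m n :: nat
  assumes "k < m * n"
  shows "k mod m < m" "k div m < n"
  using assms by (cases "m = 0"; simp add: less_mult_imp_div_less mult.commute)+

lemma vecm_carrier: "M \<in> carrier_mat m n \<Longrightarrow> vecm M \<in> carrier_vec (m * n)"
  by (auto simp: vecm_def)

text \<open>Column-stacking is the bijection between \<open>k\<close> and the pair
  \<open>(k mod m, k div m)\<close>, so sums over vectorized entries become double sums over columns
  and rows.\<close>

lemma sum_div_mod:
  fixes f :: "nat \<Rightarrow> nat \<Rightarrow> 'a :: comm_monoid_add"
  shows "(\<Sum>k<m*n. f (k mod m) (k div m)) = (\<Sum>j<n. \<Sum>i<m. f i j)"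
proof -
  have "(\<Sum>k<m*n. f (k mod m) (k div m)) = (\<Sum>(j,i)\<in>{..<n}\<times>{..<m}. f i j)"
  proof (rule sum.reindex_bij_witness[where i = "\<lambda>(j,i). i + j * m" and j = "\<lambda>k. (k div m, k mod m)"])
    fix k assume k: "k \<in> {..<m*n}"
    then have m: "0 < m" by (cases m) auto
    show "(k div m, k mod m) \<in> {..<n} \<times> {..<m}"
      using k m by (auto simp: less_mult_imp_div_less mult.commute)
  next
    fix b assume "b \<in> {..<n} \<times> {..<m}"
    then obtain j i where b: "b = (j,i)" "j < n" "i < m" by auto
    have "i + j * m < Suc j * m" using b by simp
    also have "\<dots> \<le> n * m" using b by (intro mult_le_mono1) auto
    finally show "(case b of (j,i) \<Rightarrow> i + j * m) \<in> {..<m*n}" using b by (simp add: mult.commute)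
  qed auto
  then show ?thesis by (simp add: sum.cartesian_product)
qed

lemma fnorm_nonneg [simp]: "0 \<le> fnorm M"
  by (simp add: fnorm_def)

lemma fnorm_sq:
  assumes "M \<in> carrier_mat m n"
  shows "(fnorm M)\<^sup>2 = (\<Sum>j<n. \<Sum>i<m. (M $$ (i,j))\<^sup>2)"
  using assms sum_div_mod[of "\<lambda>i j. (M $$ (i,j))\<^sup>2" m n]
  unfolding fnorm_def vnorm_sq
  by (simp add: scalar_prod_def vecm_def power2_eq_square atLeast0LessThan)

lemma fnorm_sq_cols:
  assumes "M \<in> carrier_mat m n"
  shows "(fnorm M)\<^sup>2 = (\<Sum>j<n. (vnorm (col M j))\<^sup>2)"
  using assms unfolding fnorm_sq[OF assms] vnorm_sq
  by (auto simp: scalar_prod_def power2_eq_square atLeast0LessThan intro!: sum.cong)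

lemma fnorm_transpose: "fnorm (transpose_mat M) = fnorm M"
proof -
  have "(fnorm (transpose_mat M))\<^sup>2 = (fnorm M)\<^sup>2"
    unfolding fnorm_sq[OF carrier_matI[OF refl refl, of M]]
      fnorm_sq[OF carrier_matI[OF refl refl, of "transpose_mat M"]]
    by (simp, subst sum.swap, auto intro!: sum.cong)
  then show ?thesis by simp
qed

lemma fnorm_triangle:
  assumes "M \<in> carrier_mat m n" "N \<in> carrier_mat m n"
  shows "fnorm (M + N) \<le> fnorm M + fnorm N"
proof -
  have "vecm (M + N) = vecm M + vecm N"
    using assms by (auto simp: vecm_def vec_idx_bounds intro!: eq_vecI)
  then show ?thesis
    unfolding fnorm_def using vnorm_triangle[OF vecm_carrier vecm_carrier, OF assms] by simp
qed

lemma vecm_smult: "vecm (c \<cdot>\<^sub>m M) = c \<cdot>\<^sub>v vecm M"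
  by (auto simp: vecm_def vec_idx_bounds intro!: eq_vecI)

lemma fnorm_smult: "fnorm (c \<cdot>\<^sub>m M) = \<bar>c\<bar> * fnorm M"
  by (simp add: fnorm_def vecm_smult vnorm_smult)

lemma fnorm_diff_triangle:
  assumes "M \<in> carrier_mat m n" "N \<in> carrier_mat m n"
  shows "fnorm (M - N) \<le> fnorm M + fnorm N"
proof -
  have "M - N = M + (- 1) \<cdot>\<^sub>m N"
    using assms by (intro eq_matI) auto
  then show ?thesis
    using fnorm_triangle[OF assms(1) smult_carrier_mat[OF assms(2)], of "- 1"] by (simp add: fnorm_smult)
qed

lemma add_diff_cancel_mat:
  fixes M N :: "real mat"
  assumes "M \<in> carrier_mat m n" "N \<in> carrier_mat m n"
  shows "(M + N) - N = M" "(N + M) - N = M"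
  using assms by (auto intro!: eq_matI)

lemma fnorm_four_block_sq:
  assumes "A \<in> carrier_mat m n" "B \<in> carrier_mat m n'" "C \<in> carrier_mat m' n" "D \<in> carrier_mat m' n'"
  shows "(fnorm (four_block_mat A B C D))\<^sup>2 = (fnorm A)\<^sup>2 + (fnorm B)\<^sup>2 + (fnorm C)\<^sup>2 + (fnorm D)\<^sup>2"
proof -
  have split: "(\<Sum>i<a+b. f i) = (\<Sum>i<a. f i) + (\<Sum>i<b. f (a + i))" for a b :: nat and f :: "nat \<Rightarrow> real"
    by (induction b) (auto simp: add.assoc)
  have "four_block_mat A B C D \<in> carrier_mat (m + m') (n + n')"
    using assms by simp
  then show ?thesis
    using assms by (simp add: fnorm_sq[of _ "m + m'" "n + n'"] fnorm_sq[of A m n]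
      fnorm_sq[of B m n'] fnorm_sq[of C m' n] fnorm_sq[of D m' n'] split sum.distrib)
qed

text \<open>The squared Frobenius norm is a sum over columns and \<open>P\<close> acts on each
  column separately, so an operator bound on vectors passes to matrices with the same
  constant.\<close>

lemma fnorm_mult_le:
  assumes P: "P \<in> carrier_mat m n" and X: "X \<in> carrier_mat n k" and c: "0 \<le> c"
    and le: "\<And>x. x \<in> carrier_vec n \<Longrightarrow> vnorm (P *\<^sub>v x) \<le> c * vnorm x"
  shows "fnorm (P * X) \<le> c * fnorm X"
proof -
  have "(fnorm (P * X))\<^sup>2 = (\<Sum>j<k. (vnorm (P *\<^sub>v col X j))\<^sup>2)"
    using P X by (simp add: fnorm_sq_cols[of _ m k] del: col_mult add: col_mult2)
  also have "\<dots> \<le> (\<Sum>j<k. (c * vnorm (col X j))\<^sup>2)"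
    using X by (intro sum_mono power_mono le) auto
  also have "\<dots> = (c * fnorm X)\<^sup>2"
    by (simp add: power_mult_distrib fnorm_sq_cols[OF X] sum_distrib_left)
  finally show ?thesis using c by (simp add: power2_le_iff_abs_le)
qed

lemma fnorm_mult_ge:
  assumes P: "P \<in> carrier_mat m n" and X: "X \<in> carrier_mat n k" and c: "0 \<le> c"
    and ge: "\<And>x. x \<in> carrier_vec n \<Longrightarrow> c * vnorm x \<le> vnorm (P *\<^sub>v x)"
  shows "c * fnorm X \<le> fnorm (P * X)"
proof -
  have "(c * fnorm X)\<^sup>2 = (\<Sum>j<k. (c * vnorm (col X j))\<^sup>2)"
    by (simp add: power_mult_distrib fnorm_sq_cols[OF X] sum_distrib_left)
  also have "\<dots> \<le> (\<Sum>j<k. (vnorm (P *\<^sub>v col X j))\<^sup>2)"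
    using X c by (intro sum_mono power_mono ge) auto
  also have "\<dots> = (fnorm (P * X))\<^sup>2"
    using P X by (simp add: fnorm_sq_cols[of _ m k] del: col_mult add: col_mult2)
  finally show ?thesis by (simp add: power2_le_iff_abs_le)
qed

text \<open>Right multiplication acts on rows. Transposing reduces it to left multiplication, which
  is why the hypothesis concerns \<open>transpose_mat P\<close>.\<close>

lemma fnorm_mult_right_le:
  assumes P: "P \<in> carrier_mat n k" and X: "X \<in> carrier_mat m n" and c: "0 \<le> c"
    and le: "\<And>x. x \<in> carrier_vec n \<Longrightarrow> vnorm (transpose_mat P *\<^sub>v x) \<le> c * vnorm x"
  shows "fnorm (X * P) \<le> c * fnorm X"
  using fnorm_mult_le[of "transpose_mat P" k n "transpose_mat X" m c] assms
  by (simp add: transpose_mult[symmetric] fnorm_transpose)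

lemma fnorm_mult_right_ge:
  assumes P: "P \<in> carrier_mat n k" and X: "X \<in> carrier_mat m n" and c: "0 \<le> c"
    and ge: "\<And>x. x \<in> carrier_vec n \<Longrightarrow> c * vnorm x \<le> vnorm (transpose_mat P *\<^sub>v x)"
  shows "c * fnorm X \<le> fnorm (X * P)"
  using fnorm_mult_ge[of "transpose_mat P" k n "transpose_mat X" m c] assms
  by (simp add: transpose_mult[symmetric] fnorm_transpose)

lemma vnorm_mult_sq:
  assumes "M \<in> carrier_mat m n" "v \<in> carrier_vec n"
  shows "(vnorm (M *\<^sub>v v))\<^sup>2 = v \<bullet> ((transpose_mat M * M) *\<^sub>v v)"
  using assms transpose_vec_mult_scalar[of M m n v "M *\<^sub>v v"]
  by (simp add: vnorm_sq comm_scalar_prod[of _ n])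

text \<open>Left multiplication by \<open>Q\<close> preserves the length of each column; the right
  factor is brought to the left by transposing.\<close>

lemma fnorm_isometry:
  assumes Q: "Q \<in> carrier_mat m n" "transpose_mat Q * Q = 1\<^sub>m n" and Z: "Z \<in> carrier_mat n n"
  shows "fnorm (Q * Z * transpose_mat Q) = fnorm Z"
proof -
  have iso: "vnorm (Q *\<^sub>v x) = vnorm x" if "x \<in> carrier_vec n" for x
  proof -
    have "(vnorm (Q *\<^sub>v x))\<^sup>2 = (vnorm x)\<^sup>2"
      using vnorm_mult_sq[OF Q(1) that] that by (simp add: Q(2) vnorm_sq[of x])
    then show ?thesis by simp
  qed
  have left: "fnorm (Q * Y) = fnorm Y" if "Y \<in> carrier_mat n k" for Y k
    using fnorm_mult_le[of Q m n Y k 1] fnorm_mult_ge[of Q m n Y k 1] that Q iso by fastforce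
  have QZ: "Q * Z \<in> carrier_mat m n" using Q Z by simp
  have "fnorm (Q * Z * transpose_mat Q) = fnorm (transpose_mat (Q * Z * transpose_mat Q))"
    by (simp only: fnorm_transpose)
  also have "transpose_mat (Q * Z * transpose_mat Q) = Q * transpose_mat (Q * Z)"
    using transpose_mult[OF QZ, of "transpose_mat Q" m] Q by simp
  also have "fnorm \<dots> = fnorm (Q * Z)"
    using left[of "transpose_mat (Q * Z)" m] QZ by (simp add: fnorm_transpose)
  also have "\<dots> = fnorm Z" using left[OF Z] .
  finally show ?thesis .
qed

section \<open>Extremal eigenvalues of symmetric matrices\<close>

text \<open>Compactness of the unit sphere. Vectors are modelled as functions on all naturals
  because the product topology then supplies compactness through Tychonoff's theorem.\<close>

lemma quadratic_form_minimum:
  fixes g :: "nat \<Rightarrow> nat \<Rightarrow> real"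
  assumes n: "0 < n"
  obtains x where "(\<Sum>i<n. (x i)\<^sup>2) = 1"
    "\<And>y. (\<Sum>i<n. (y i)\<^sup>2) = 1 \<Longrightarrow>
        (\<Sum>i<n. \<Sum>j<n. x i * g i j * x j) \<le> (\<Sum>i<n. \<Sum>j<n. y i * g i j * y j)"
proof -
  define q where "q = (\<lambda>y :: nat \<Rightarrow> real. \<Sum>i<n. \<Sum>j<n. y i * g i j * y j)"
  define s where "s = (\<lambda>y :: nat \<Rightarrow> real. \<Sum>i<n. (y i)\<^sup>2)"
  \<comment> \<open>The sphere condition sees only the first \<open>n\<close> coordinates.
    Intersecting with the cube confines the remaining ones, so \<open>K\<close> is the intersection
    of a compact product with a closed set.\<close>
  define K where "K = (PiE UNIV (\<lambda>_. {-1..1}) :: (nat \<Rightarrow> real) set) \<inter> (s -` {1})"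
  have coord: "continuous_on S (\<lambda>y :: nat \<Rightarrow> real. y i)" for i S
    by (rule continuous_on_subset[OF continuous_on_product_coordinates]) auto
  have "compact (PiE UNIV (\<lambda>_. {-1..1}) :: (nat \<Rightarrow> real) set)"
    using compactin_PiE[of "\<lambda>_. euclidean" UNIV "\<lambda>_::nat. {-1..1::real}"]
    by (simp add: euclidean_product_topology)
  moreover have "closed (s -` {1})"
    unfolding s_def by (intro closed_vimage) (auto intro!: continuous_intros coord)
  ultimately have "compact K"
    unfolding K_def by (rule compact_Int_closed)
  moreover have "(\<lambda>i. if i = 0 then 1 else 0) \<in> K"
    using n by (auto simp: K_def s_def if_distrib[of "\<lambda>x. x\<^sup>2"] cong: if_cong)
  then have "K \<noteq> {}" by blast
  moreover have "continuous_on K q"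
    unfolding q_def by (intro continuous_intros coord)
  ultimately obtain x where x: "x \<in> K" "\<And>y. y \<in> K \<Longrightarrow> q x \<le> q y"
    using continuous_attains_inf[of K q] by blast
  show thesis
  proof
    show "(\<Sum>i<n. (x i)\<^sup>2) = 1" using x(1) by (simp add: K_def s_def)
    fix y :: "nat \<Rightarrow> real" assume y: "(\<Sum>i<n. (y i)\<^sup>2) = 1"
    \<comment> \<open>A competitor may be arbitrary from index \<open>n\<close> on; setting those
      coordinates to zero brings it into \<open>K\<close> without changing the form or the
      norm.\<close>
    define y' where "y' = (\<lambda>i. if i < n then y i else 0)"
    have "\<bar>y i\<bar> \<le> 1" if "i < n" for i
    proof -
      have "(y i)\<^sup>2 \<le> (\<Sum>i<n. (y i)\<^sup>2)"
        using that by (intro member_le_sum) auto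
      then show ?thesis using y abs_le_square_iff[of "y i" 1] by simp
    qed
    then have "y' \<in> K"
      using y by (auto simp: K_def s_def y'_def abs_le_iff neg_le_iff_le minus_le_iff)
    then have "q x \<le> q y'" by (rule x(2))
    then show "(\<Sum>i<n. \<Sum>j<n. x i * g i j * x j) \<le> (\<Sum>i<n. \<Sum>j<n. y i * g i j * y j)"
      by (simp add: q_def y'_def)
  qed
qed

text \<open>A minimizer \<open>v\<close> of the form on the unit sphere is an eigenvector for the
  minimal value \<open>l\<close>: a nonzero residual \<open>G v - l v\<close> would give a direction
  in which the Rayleigh quotient decreases.\<close>

lemma symmetric_min_eigenvector:
  assumes G: "(G :: real mat) \<in> carrier_mat n n" and sym: "transpose_mat G = G" and n: "0 < n"
  obtains l v where "v \<in> carrier_vec n" "v \<noteq> 0\<^sub>v n" "G *\<^sub>v v = l \<cdot>\<^sub>v v"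
    "\<And>x. x \<in> carrier_vec n \<Longrightarrow> l * (x \<bullet> x) \<le> x \<bullet> (G *\<^sub>v x)"
proof -
  have form: "y \<bullet> (G *\<^sub>v y) = (\<Sum>i<n. \<Sum>j<n. y $ i * G $$ (i,j) * y $ j)"
    if "y \<in> carrier_vec n" for y
    using that G by (simp add: scalar_prod_def sum_distrib_left mult.assoc atLeast0LessThan)
  have self: "y \<bullet> y = (\<Sum>i<n. (y $ i)\<^sup>2)" if "y \<in> carrier_vec n" for y :: "real vec"
    using that by (simp add: scalar_prod_def power2_eq_square atLeast0LessThan)
  obtain x where x: "(\<Sum>i<n. (x i)\<^sup>2) = 1"
    "\<And>y. (\<Sum>i<n. (y i)\<^sup>2) = 1 \<Longrightarrow>
        (\<Sum>i<n. \<Sum>j<n. x i * G $$ (i,j) * x j) \<le> (\<Sum>i<n. \<Sum>j<n. y i * G $$ (i,j) * y j)"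
    using quadratic_form_minimum[OF n, of "\<lambda>i j. G $$ (i,j)"] by blast
  define v where "v = vec n x"
  have v: "v \<in> carrier_vec n" by (simp add: v_def)
  have vv: "v \<bullet> v = 1" using x(1) by (simp add: self[OF v]) (simp add: v_def)
  define l where "l = v \<bullet> (G *\<^sub>v v)"
  have unit: "l \<le> y \<bullet> (G *\<^sub>v y)" if y: "y \<in> carrier_vec n" "y \<bullet> y = 1" for y
    using x(2)[of "\<lambda>i. y $ i"] y unfolding l_def form[OF v] form[OF y(1)] self[OF y(1)]
    by (simp add: v_def)
  have rayleigh: "l * (y \<bullet> y) \<le> y \<bullet> (G *\<^sub>v y)" if y: "y \<in> carrier_vec n" for y
  proof (cases "y = 0\<^sub>v n")
    case True
    then show ?thesis using G by simp
  next
    case False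
    define c where "c = 1 / vnorm y"
    have pos: "0 < vnorm y"
      using False y vnorm_eq_0_iff[of y n] vnorm_nonneg[of y] by linarith
    have yy: "y \<bullet> y = (vnorm y)\<^sup>2" by (simp add: vnorm_sq)
    have "(c \<cdot>\<^sub>v y) \<bullet> (c \<cdot>\<^sub>v y) = c * c * (y \<bullet> y)" using y by simp
    then have "(c \<cdot>\<^sub>v y) \<bullet> (c \<cdot>\<^sub>v y) = 1"
      using pos by (simp add: c_def yy power2_eq_square)
    then have "l \<le> (c \<cdot>\<^sub>v y) \<bullet> (G *\<^sub>v (c \<cdot>\<^sub>v y))"
      using y by (intro unit) auto
    also have "\<dots> = c * c * (y \<bullet> (G *\<^sub>v y))"
      using y G by (simp add: mult_mat_vec[OF G y])
    finally show ?thesis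
      using pos by (simp add: c_def yy field_simps power2_eq_square)
  qed
  define w where "w = G *\<^sub>v v - l \<cdot>\<^sub>v v"
  have w: "w \<in> carrier_vec n" using G v by (simp add: w_def)
  have Gv: "G *\<^sub>v v \<in> carrier_vec n" and Gw: "G *\<^sub>v w \<in> carrier_vec n" using G v w by auto
  have cross: "v \<bullet> (G *\<^sub>v w) = w \<bullet> (G *\<^sub>v v)"
    using transpose_vec_mult_scalar[OF G w v] Gv sym w by (simp add: comm_scalar_prod[of _ n])
  have ww: "w \<bullet> w = w \<bullet> (G *\<^sub>v v) - l * (w \<bullet> v)"
    using w v Gv by (simp add: w_def scalar_prod_minus_distrib[of _ n])
  define c where "c = w \<bullet> (G *\<^sub>v w) - l * (w \<bullet> w)"
  \<comment> \<open>The Rayleigh bound at \<open>v + t w\<close>: the constant terms cancel, and by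
    \<open>ww\<close> the linear coefficient is twice the squared length of the residual
    \<open>w\<close>.\<close>
  have quad: "0 \<le> 2 * t * (w \<bullet> w) + t\<^sup>2 * c" for t
  proof -
    have "l * ((v + t \<cdot>\<^sub>v w) \<bullet> (v + t \<cdot>\<^sub>v w)) \<le> (v + t \<cdot>\<^sub>v w) \<bullet> (G *\<^sub>v (v + t \<cdot>\<^sub>v w))"
      using v w by (intro rayleigh) auto
    also have "(v + t \<cdot>\<^sub>v w) \<bullet> (v + t \<cdot>\<^sub>v w) = 1 + 2 * t * (w \<bullet> v) + t\<^sup>2 * (w \<bullet> w)"
      using v w comm_scalar_prod[OF v w]
      by (simp add: add_scalar_prod_distrib[of _ n] scalar_prod_add_distrib[of _ n] vv
          power2_eq_square algebra_simps)
    also have "G *\<^sub>v (v + t \<cdot>\<^sub>v w) = G *\<^sub>v v + t \<cdot>\<^sub>v (G *\<^sub>v w)"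
      using G v w by (simp add: mult_add_distrib_mat_vec[of _ n n] mult_mat_vec[of _ n n])
    also have "(v + t \<cdot>\<^sub>v w) \<bullet> \<dots> = l + 2 * t * (w \<bullet> (G *\<^sub>v v)) + t\<^sup>2 * (w \<bullet> (G *\<^sub>v w))"
      using v w Gv Gw
      by (simp add: add_scalar_prod_distrib[of _ n] scalar_prod_add_distrib[of _ n] cross
          l_def[symmetric] power2_eq_square algebra_simps)
    finally show ?thesis unfolding ww c_def by (simp add: algebra_simps)
  qed
  have "w \<bullet> w = 0"
  proof -
    define a where "a = w \<bullet> w"
    \<comment> \<open>Chosen positive and larger than \<open>c\<close>, so that at
      \<open>t = - a / d\<close> the quadratic is at most \<open>- (a^2 / d)\<close>, which forces
      \<open>a = 0\<close>.\<close>
    define d where "d = \<bar>c\<bar> + 1"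
    have d: "0 < d" "c \<le> d - 1" by (auto simp: d_def)
    have "0 \<le> 2 * (- a / d) * a + (- a / d)\<^sup>2 * c"
      using quad[of "- a / d"] by (simp add: a_def)
    also have "\<dots> \<le> 2 * (- a / d) * a + (- a / d)\<^sup>2 * d"
      using d by (intro add_left_mono mult_left_mono) auto
    also have "\<dots> = - (a\<^sup>2 / d)" using d by (simp add: power2_eq_square field_simps)
    finally have "a\<^sup>2 / d \<le> 0" by linarith
    then have "a = 0" using d by (simp add: divide_le_0_iff not_le)
    then show ?thesis by (simp add: a_def)
  qed
  then have "w = 0\<^sub>v n" using vnorm_sq[of w] vnorm_eq_0_iff[OF w] by simp
  have "G *\<^sub>v v = l \<cdot>\<^sub>v v"
  proof (rule eq_vecI)
    fix i assume "i < dim_vec (l \<cdot>\<^sub>v v)"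
    then have "i < n" using v by simp
    then have "w $ i = 0" using \<open>w = 0\<^sub>v n\<close> by simp
    then show "(G *\<^sub>v v) $ i = (l \<cdot>\<^sub>v v) $ i" using \<open>i < n\<close> v Gv unfolding w_def by simp
  qed (use v G in auto)
  moreover have "v \<noteq> 0\<^sub>v n" using vv v by auto
  ultimately show thesis using that v rayleigh by blast
qed

lemma finite_eigenvalues:
  assumes "(G :: real mat) \<in> carrier_mat n n"
  shows "finite {l. eigenvalue G l}"
  using card_finite_spectrum(1)[OF assms] by (simp add: spectrum_def)

lemma finite_abs_eigenvalues:
  assumes "(G :: real mat) \<in> carrier_mat n n"
  shows "finite {\<bar>l\<bar> | l. eigenvalue G l}"
proof -
  have "{\<bar>l\<bar> | l. eigenvalue G l} = abs ` {l. eigenvalue G l}" by auto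
  then show ?thesis using finite_eigenvalues[OF assms] by simp
qed

lemma eigenvalueE:
  assumes "eigenvalue G l" "(G :: real mat) \<in> carrier_mat n n"
  obtains v where "v \<in> carrier_vec n" "v \<noteq> 0\<^sub>v n" "G *\<^sub>v v = l \<cdot>\<^sub>v v" "0 < v \<bullet> v"
proof -
  obtain v where v: "v \<in> carrier_vec n" "v \<noteq> 0\<^sub>v n" "G *\<^sub>v v = l \<cdot>\<^sub>v v"
    using assms by (auto simp: eigenvalue_def eigenvector_def)
  then have "0 < vnorm v" using vnorm_eq_0_iff[of v n] vnorm_nonneg[of v] by linarith
  then have "0 < v \<bullet> v" unfolding vnorm_sq[symmetric] by simp
  then show thesis using that v by blast
qed

lemma eigenvalueI:
  assumes "v \<in> carrier_vec n" "v \<noteq> 0\<^sub>v n" "G *\<^sub>v v = l \<cdot>\<^sub>v v" "(G :: real mat) \<in> carrier_mat n n"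
  shows "eigenvalue G l"
  using assms by (auto simp: eigenvalue_def eigenvector_def)

text \<open>Every eigenvalue is the Rayleigh quotient of its eigenvector, so none lies below the
  minimum of the form, and that minimum is itself an eigenvalue.\<close>

lemma Min_eigenvalue_rayleigh:
  assumes G: "(G :: real mat) \<in> carrier_mat n n" and sym: "transpose_mat G = G" and n: "0 < n"
  shows "eigenvalue G (Min {l. eigenvalue G l})"
    and "x \<in> carrier_vec n \<Longrightarrow> Min {l. eigenvalue G l} * (x \<bullet> x) \<le> x \<bullet> (G *\<^sub>v x)"
proof -
  obtain l v where v: "v \<in> carrier_vec n" "v \<noteq> 0\<^sub>v n" "G *\<^sub>v v = l \<cdot>\<^sub>v v"
    and ray: "\<And>x. x \<in> carrier_vec n \<Longrightarrow> l * (x \<bullet> x) \<le> x \<bullet> (G *\<^sub>v x)"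
    using symmetric_min_eigenvector[OF assms] by blast
  have ev: "eigenvalue G l" using eigenvalueI[OF v G] .
  moreover have "l \<le> k" if k: "eigenvalue G k" for k
  proof -
    obtain u where u: "u \<in> carrier_vec n" "G *\<^sub>v u = k \<cdot>\<^sub>v u" "0 < u \<bullet> u"
      using eigenvalueE[OF k G] by blast
    then show ?thesis using ray[of u] by simp
  qed
  ultimately have "Min {l. eigenvalue G l} = l"
    using finite_eigenvalues[OF G] by (intro Min_eqI) auto
  then show "eigenvalue G (Min {l. eigenvalue G l})"
    "x \<in> carrier_vec n \<Longrightarrow> Min {l. eigenvalue G l} * (x \<bullet> x) \<le> x \<bullet> (G *\<^sub>v x)"
    using ev ray by auto
qed

text \<open>The minimum principle applied to \<open>- G\<close>.\<close>

lemma Max_eigenvalue_rayleigh: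
  assumes G: "(G :: real mat) \<in> carrier_mat n n" and sym: "transpose_mat G = G" and n: "0 < n"
  shows "eigenvalue G (Max {l. eigenvalue G l})"
    and "x \<in> carrier_vec n \<Longrightarrow> x \<bullet> (G *\<^sub>v x) \<le> Max {l. eigenvalue G l} * (x \<bullet> x)"
proof -
  have neg: "(- G) *\<^sub>v x = - (G *\<^sub>v x)" if "x \<in> carrier_vec n" for x
    using that G by (auto intro!: eq_vecI)
  have "transpose_mat (- G) = - G" using sym by (metis transpose_uminus)
  then obtain l v where v: "v \<in> carrier_vec n" "v \<noteq> 0\<^sub>v n" "(- G) *\<^sub>v v = l \<cdot>\<^sub>v v"
    and ray: "\<And>x. x \<in> carrier_vec n \<Longrightarrow> l * (x \<bullet> x) \<le> x \<bullet> ((- G) *\<^sub>v x)"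
    using symmetric_min_eigenvector[of "- G" n] G n by (metis uminus_carrier_iff_mat)
  have ray': "x \<bullet> (G *\<^sub>v x) \<le> - l * (x \<bullet> x)" if "x \<in> carrier_vec n" for x
    using ray[OF that] neg[OF that] that G by simp
  have "- (- (G *\<^sub>v v)) = - (l \<cdot>\<^sub>v v)" using v(3) neg[OF v(1)] by simp
  then have "G *\<^sub>v v = (- l) \<cdot>\<^sub>v v"
    by (auto simp: vec_eq_iff)
  then have ev: "eigenvalue G (- l)" using eigenvalueI[OF v(1,2) _ G] by blast
  moreover have "k \<le> - l" if k: "eigenvalue G k" for k
  proof -
    obtain u where u: "u \<in> carrier_vec n" "G *\<^sub>v u = k \<cdot>\<^sub>v u" "0 < u \<bullet> u"
      using eigenvalueE[OF k G] by blast
    then have "k * (u \<bullet> u) \<le> - l * (u \<bullet> u)" using ray'[of u] by simp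
    then show ?thesis using u(3) mult_le_cancel_right_pos by blast
  qed
  ultimately have "Max {l. eigenvalue G l} = - l"
    using finite_eigenvalues[OF G] by (intro Max_eqI) auto
  then show "eigenvalue G (Max {l. eigenvalue G l})"
    "x \<in> carrier_vec n \<Longrightarrow> x \<bullet> (G *\<^sub>v x) \<le> Max {l. eigenvalue G l} * (x \<bullet> x)"
    using ev ray' by auto
qed

section \<open>Singular values as extremal stretching factors\<close>

lemma gram_carrier:
  fixes M :: "real mat"
  assumes "M \<in> carrier_mat m n"
  shows "transpose_mat M * M \<in> carrier_mat n n" "transpose_mat (transpose_mat M * M) = transpose_mat M * M"
  using assms transpose_mult[of "transpose_mat M" n m M n] by auto

text \<open>An eigenvalue of the Gram matrix is the squared factor by which \<open>M\<close>
  stretches its eigenvector, hence nonnegative.\<close>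

lemma gram_eigenvalueE:
  assumes M: "M \<in> carrier_mat m n" and l: "eigenvalue (transpose_mat M * M) l"
  obtains v where "v \<in> carrier_vec n" "0 < vnorm v" "(vnorm (M *\<^sub>v v))\<^sup>2 = l * (vnorm v)\<^sup>2" "0 \<le> l"
proof -
  obtain v where v: "v \<in> carrier_vec n" "(transpose_mat M * M) *\<^sub>v v = l \<cdot>\<^sub>v v" "0 < v \<bullet> v"
    using eigenvalueE[OF l gram_carrier(1)[OF M]] by blast
  have eq: "(vnorm (M *\<^sub>v v))\<^sup>2 = l * (v \<bullet> v)"
    unfolding vnorm_mult_sq[OF M v(1)] v(2) using v(1) by simp
  then have "0 \<le> l * (v \<bullet> v)" by (metis zero_le_power2)
  then have "0 \<le> l" using v(3) by (simp add: zero_le_mult_iff)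
  moreover have "0 < vnorm v"
    using v(3) vnorm_nonneg[of v] unfolding vnorm_sq[symmetric] by (simp add: less_le)
  ultimately show thesis using that v(1) eq by (simp add: vnorm_sq)
qed

context
  fixes M :: "real mat" and m n :: nat
  assumes M: "M \<in> carrier_mat m n" and n: "0 < n"
begin

lemma sigma_min_nonneg: "0 \<le> sigma_min M"
  unfolding sigma_min_def
  by (rule gram_eigenvalueE[OF M Min_eigenvalue_rayleigh(1)[OF gram_carrier[OF M] n]]) simp

lemma spec_norm_nonneg: "0 \<le> spec_norm M"
  unfolding spec_norm_def
  by (rule gram_eigenvalueE[OF M Max_eigenvalue_rayleigh(1)[OF gram_carrier[OF M] n]]) simp

lemma sigma_min_mult_le:
  assumes x: "x \<in> carrier_vec n"
  shows "sigma_min M * vnorm x \<le> vnorm (M *\<^sub>v x)"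
proof (rule power2_le_imp_le)
  let ?l = "Min {l. eigenvalue (transpose_mat M * M) l}"
  have "0 \<le> ?l"
    using gram_eigenvalueE[OF M Min_eigenvalue_rayleigh(1)[OF gram_carrier[OF M] n]] by blast
  then have "(sigma_min M * vnorm x)\<^sup>2 = ?l * (x \<bullet> x)"
    by (simp add: sigma_min_def power_mult_distrib vnorm_sq)
  also have "\<dots> \<le> (vnorm (M *\<^sub>v x))\<^sup>2"
    unfolding vnorm_mult_sq[OF M x]
    by (rule Min_eigenvalue_rayleigh(2)[OF gram_carrier[OF M] n x])
  finally show "(sigma_min M * vnorm x)\<^sup>2 \<le> (vnorm (M *\<^sub>v x))\<^sup>2" .
qed simp

lemma spec_norm_mult_ge:
  assumes x: "x \<in> carrier_vec n"
  shows "vnorm (M *\<^sub>v x) \<le> spec_norm M * vnorm x"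
proof (rule power2_le_imp_le)
  let ?l = "Max {l. eigenvalue (transpose_mat M * M) l}"
  have "0 \<le> ?l"
    using gram_eigenvalueE[OF M Max_eigenvalue_rayleigh(1)[OF gram_carrier[OF M] n]] by blast
  then have "(spec_norm M * vnorm x)\<^sup>2 = ?l * (x \<bullet> x)"
    by (simp add: spec_norm_def power_mult_distrib vnorm_sq)
  moreover have "(vnorm (M *\<^sub>v x))\<^sup>2 \<le> ?l * (x \<bullet> x)"
    unfolding vnorm_mult_sq[OF M x]
    by (rule Max_eigenvalue_rayleigh(2)[OF gram_carrier[OF M] n x])
  ultimately show "(vnorm (M *\<^sub>v x))\<^sup>2 \<le> (spec_norm M * vnorm x)\<^sup>2" by simp
  show "0 \<le> spec_norm M * vnorm x" using spec_norm_nonneg by simp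
qed

text \<open>The bound is tested on an eigenvector of the smallest Gram eigenvalue, which
  \<open>M\<close> stretches by exactly \<open>sigma_min M\<close>.\<close>

lemma sigma_min_geI:
  assumes "\<And>x. x \<in> carrier_vec n \<Longrightarrow> s * vnorm x \<le> vnorm (M *\<^sub>v x)"
  shows "s \<le> sigma_min M"
proof -
  obtain v where v: "v \<in> carrier_vec n" "0 < vnorm v"
    "(vnorm (M *\<^sub>v v))\<^sup>2 = Min {l. eigenvalue (transpose_mat M * M) l} * (vnorm v)\<^sup>2"
    using gram_eigenvalueE[OF M Min_eigenvalue_rayleigh(1)[OF gram_carrier[OF M] n]] by blast
  have "sqrt ((vnorm (M *\<^sub>v v))\<^sup>2) = sigma_min M * vnorm v"
    unfolding v(3) sigma_min_def by (simp add: real_sqrt_mult)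
  then have "s * vnorm v \<le> sigma_min M * vnorm v"
    using assms[OF v(1)] by simp
  then show ?thesis using v(2) by simp
qed

lemma spec_norm_leI:
  assumes "\<And>x. x \<in> carrier_vec n \<Longrightarrow> vnorm (M *\<^sub>v x) \<le> s * vnorm x"
  shows "spec_norm M \<le> s"
proof -
  obtain v where v: "v \<in> carrier_vec n" "0 < vnorm v"
    "(vnorm (M *\<^sub>v v))\<^sup>2 = Max {l. eigenvalue (transpose_mat M * M) l} * (vnorm v)\<^sup>2"
    using gram_eigenvalueE[OF M Max_eigenvalue_rayleigh(1)[OF gram_carrier[OF M] n]] by blast
  have "sqrt ((vnorm (M *\<^sub>v v))\<^sup>2) = spec_norm M * vnorm v"
    unfolding v(3) spec_norm_def by (simp add: real_sqrt_mult)
  then have "spec_norm M * vnorm v \<le> s * vnorm v"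
    using assms[OF v(1)] by simp
  then show ?thesis using v(2) by simp
qed

text \<open>For z = M^T y, Cauchy-Schwarz gives |z|^2 = y . Mz <= |y| |M| |z|, and a factor |z|
  cancels unless it is zero. This avoids comparing the spectra of M^T M and M M^T.\<close>

lemma spec_norm_transpose_mult_ge:
  assumes y: "y \<in> carrier_vec m"
  shows "vnorm (transpose_mat M *\<^sub>v y) \<le> spec_norm M * vnorm y"
proof -
  let ?z = "transpose_mat M *\<^sub>v y"
  have z: "?z \<in> carrier_vec n" using M y by simp
  have "(vnorm ?z)\<^sup>2 = y \<bullet> (M *\<^sub>v ?z)"
    unfolding vnorm_sq using transpose_vec_mult_scalar[OF M z y] .
  also have "\<dots> \<le> vnorm y * vnorm (M *\<^sub>v ?z)"
    using scalar_prod_le_vnorm[of y m "M *\<^sub>v ?z"] M y z by simp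
  also have "\<dots> \<le> vnorm y * (spec_norm M * vnorm ?z)"
    by (intro mult_left_mono spec_norm_mult_ge z) simp
  finally have "vnorm ?z * vnorm ?z \<le> (spec_norm M * vnorm y) * vnorm ?z"
    by (simp add: power2_eq_square algebra_simps)
  moreover have "0 \<le> spec_norm M * vnorm y" using spec_norm_nonneg by simp
  ultimately show ?thesis
    by (metis linorder_not_less mult_le_cancel_right order_le_less_trans)
qed

end

text \<open>For symmetric \<open>M\<close> the Gram matrix is the square of \<open>M\<close>, so its
  eigenvector \<open>v\<close> for s^2 satisfies (M - s)(M + s) v = 0. Either u = (M + s) v vanishes
  and -s is an eigenvalue of \<open>M\<close>, or \<open>u\<close> is an eigenvector for s.\<close>

lemma eig_min_abs_le_sigma_min:
  assumes M: "M \<in> carrier_mat n n" and sym: "transpose_mat M = M" and n: "0 < n"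
  shows "eig_min_abs M \<le> sigma_min M"
proof -
  let ?r = "Min {l. eigenvalue (transpose_mat M * M) l}"
  define s where "s = sigma_min M"
  have ev: "eigenvalue (transpose_mat M * M) ?r"
    using Min_eigenvalue_rayleigh(1)[OF gram_carrier[OF M] n] .
  then have "0 \<le> ?r" using gram_eigenvalueE[OF M] by blast
  then have r: "?r = s * s" and s: "0 \<le> s" by (auto simp: s_def sigma_min_def)
  obtain v where v: "v \<in> carrier_vec n" "v \<noteq> 0\<^sub>v n" "(transpose_mat M * M) *\<^sub>v v = (s * s) \<cdot>\<^sub>v v"
    using eigenvalueE[OF ev gram_carrier(1)[OF M]] r by metis
  define u where "u = M *\<^sub>v v + s \<cdot>\<^sub>v v"
  have u: "u \<in> carrier_vec n" using M v by (simp add: u_def)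
  have "\<exists>l. eigenvalue M l \<and> \<bar>l\<bar> = s"
  proof (cases "u = 0\<^sub>v n")
    case True
    have "M *\<^sub>v v = (- s) \<cdot>\<^sub>v v"
    proof (rule eq_vecI)
      fix i assume "i < dim_vec ((- s) \<cdot>\<^sub>v v)"
      then have "i < n" using v by simp
      then have "u $ i = 0" using True by simp
      then show "(M *\<^sub>v v) $ i = ((- s) \<cdot>\<^sub>v v) $ i"
        using \<open>i < n\<close> v M unfolding u_def by simp
    qed (use v M in auto)
    then show ?thesis using eigenvalueI[OF v(1,2) _ M] s by fastforce
  next
    case False
    have MM: "M *\<^sub>v (M *\<^sub>v v) = (s * s) \<cdot>\<^sub>v v"
      using v(3) M v(1) by (simp add: sym)
    have "M *\<^sub>v u = (s * s) \<cdot>\<^sub>v v + s \<cdot>\<^sub>v (M *\<^sub>v v)"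
      using M v by (simp add: u_def mult_add_distrib_mat_vec[of _ n n] mult_mat_vec[of _ n n] MM)
    also have "\<dots> = s \<cdot>\<^sub>v u"
      using M v by (auto simp: u_def algebra_simps intro!: eq_vecI)
    finally show ?thesis using eigenvalueI[OF u False _ M] s by fastforce
  qed
  then have "s \<in> {\<bar>l\<bar> | l. eigenvalue M l}" by blast
  moreover have "finite {\<bar>l\<bar> | l. eigenvalue M l}"
    by (rule finite_abs_eigenvalues[OF M])
  ultimately show ?thesis unfolding eig_min_abs_def s_def[symmetric] by (rule Min_le[rotated])
qed

lemma eig_min_abs_pos:
  assumes M: "M \<in> carrier_mat n n" and sym: "transpose_mat M = M" and n: "0 < n"
    and inv: "invertible_mat M"
  shows "0 < eig_min_abs M"
proof -
  have "finite {\<bar>l\<bar> | l. eigenvalue M l}"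
    by (rule finite_abs_eigenvalues[OF M])
  moreover have "{\<bar>l\<bar> | l. eigenvalue M l} \<noteq> {}"
    using Min_eigenvalue_rayleigh(1)[OF M sym n] by blast
  ultimately have "eig_min_abs M \<in> {\<bar>l\<bar> | l. eigenvalue M l}"
    unfolding eig_min_abs_def by (rule Min_in)
  then obtain l where l: "eig_min_abs M = \<bar>l\<bar>" "eigenvalue M l" by blast
  have "l \<noteq> 0"
  proof
    assume "l = 0"
    then obtain v where v: "v \<in> carrier_vec n" "v \<noteq> 0\<^sub>v n" "M *\<^sub>v v = 0 \<cdot>\<^sub>v v"
      using eigenvalueE[OF l(2) M] by metis
    have "0 \<cdot>\<^sub>v v = 0\<^sub>v n" using v(1) by (intro eq_vecI) auto
    then have Mv: "M *\<^sub>v v = 0\<^sub>v n" using v(3) by simp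
    obtain B where B: "B * M = 1\<^sub>m (dim_row B)" "M * B = 1\<^sub>m n"
      using inv M by (auto simp: invertible_mat_def inverts_mat_def)
    \<comment> \<open>\<open>invertible_mat\<close> leaves the size of the inverse open; comparing
      column counts in the two identities recovers it.\<close>
    have "dim_col (B * M) = dim_col (1\<^sub>m (dim_row B))" "dim_col (M * B) = dim_col (1\<^sub>m n)"
      unfolding B by simp_all
    then have Bc: "B \<in> carrier_mat n n" using M by auto
    have "v = (B * M) *\<^sub>v v" using B Bc v by simp
    also have "\<dots> = B *\<^sub>v (M *\<^sub>v v)" by (rule assoc_mult_mat_vec[OF Bc M v(1)])
    also have "\<dots> = 0\<^sub>v n" unfolding Mv using Bc by (intro eq_vecI) auto
    finally show False using v(2) by simp
  qed
  then show ?thesis using l by simp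
qed

section \<open>Vectorization\<close>

text \<open>Position \<open>t\<close> stands for row \<open>t mod m\<close> and column
  \<open>t div m\<close>. Splitting the summation index in the same way turns a row of the Kronecker
  product into the double sum that defines an entry of the triple product.\<close>

lemma kron_mult_vecm:
  assumes A: "A \<in> carrier_mat l k" and B: "B \<in> carrier_mat m n" and X: "X \<in> carrier_mat n k"
  shows "kron A B *\<^sub>v vecm X = vecm (B * X * transpose_mat A)"
proof (rule eq_vecI)
  show dim: "dim_vec (kron A B *\<^sub>v vecm X) = dim_vec (vecm (B * X * transpose_mat A))"
    using assms by (simp add: kron_def vecm_def)
  fix t assume "t < dim_vec (vecm (B * X * transpose_mat A))"
  then have t: "t < m * l" using A B by (simp add: vecm_def)
  note b = vec_idx_bounds[OF t]
  have "(kron A B *\<^sub>v vecm X) $ t =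
      (\<Sum>s<n*k. A $$ (t div m, s div n) * B $$ (t mod m, s mod n) * X $$ (s mod n, s div n))"
    using assms t by (simp add: kron_def vecm_def scalar_prod_def atLeast0LessThan mult.commute)
  also have "\<dots> = (\<Sum>j<k. \<Sum>i<n. A $$ (t div m, j) * B $$ (t mod m, i) * X $$ (i, j))"
    by (rule sum_div_mod[of "\<lambda>i j. A $$ (t div m, j) * B $$ (t mod m, i) * X $$ (i, j)"])
  also have "\<dots> = (B * X * transpose_mat A) $$ (t mod m, t div m)"
    using assms b
    by (simp add: scalar_prod_def atLeast0LessThan sum_distrib_left mult_ac) (rule sum.swap)
  also have "\<dots> = vecm (B * X * transpose_mat A) $ t"
    using A B t by (simp add: vecm_def)
  finally show "(kron A B *\<^sub>v vecm X) $ t = vecm (B * X * transpose_mat A) $ t" .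
qed

lemma kron_carrier:
  "A \<in> carrier_mat l k \<Longrightarrow> B \<in> carrier_mat m n \<Longrightarrow> kron A B \<in> carrier_mat (l * m) (k * n)"
  by (auto simp: kron_def)

lemma vecm_add:
  "M \<in> carrier_mat m n \<Longrightarrow> N \<in> carrier_mat m n \<Longrightarrow> vecm (M + N) = vecm M + vecm N"
  by (auto simp: vecm_def vec_idx_bounds intro!: eq_vecI)

lemma vecm_diff:
  "M \<in> carrier_mat m n \<Longrightarrow> N \<in> carrier_mat m n \<Longrightarrow> vecm (M - N) = vecm M - vecm N"
  by (auto simp: vecm_def vec_idx_bounds intro!: eq_vecI)

lemma vecm_surj:
  assumes "v \<in> carrier_vec (m * n)"
  obtains B where "B \<in> carrier_mat m n" "vecm B = v"
proof
  show "mat m n (\<lambda>(i,j). v $ (i + j * m)) \<in> carrier_mat m n" by simp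
  show "vecm (mat m n (\<lambda>(i,j). v $ (i + j * m))) = v"
    using assms by (intro eq_vecI) (auto simp: vecm_def vec_idx_bounds)
qed

lemma commut_mult_vecm:
  assumes X: "X \<in> carrier_mat p p"
  shows "commut p p *\<^sub>v vecm X = vecm (transpose_mat X)"
proof (rule eq_vecI)
  show "dim_vec (commut p p *\<^sub>v vecm X) = dim_vec (vecm (transpose_mat X))"
    using X by (simp add: commut_def vecm_def)
  fix l assume "l < dim_vec (vecm (transpose_mat X))"
  then have l: "l < p * p" using X by (simp add: vecm_def)
  note b = vec_idx_bounds[OF l]
  \<comment> \<open>The position of the entry whose row and column are those of \<open>l\<close>
    exchanged; it is the only column in which row \<open>l\<close> of the commutation matrix is
    nonzero.\<close>
  define k0 where "k0 = l div p + (l mod p) * p"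
  have "k0 < Suc (l mod p) * p" using b by (simp add: k0_def)
  also have "\<dots> \<le> p * p" using Suc_leI[OF b(1)] by (rule mult_le_mono1)
  finally have k0: "k0 < p * p" .
  have "(commut p p *\<^sub>v vecm X) $ l =
      (\<Sum>k<p*p. (if k = k0 then 1 else 0) * X $$ (k mod p, k div p))"
    using X l by (simp add: commut_def vecm_def scalar_prod_def atLeast0LessThan k0_def)
  also have "\<dots> = X $$ (k0 mod p, k0 div p)"
    using k0 by (simp add: if_distrib[of "\<lambda>x. x * _"] cong: if_cong)
  also have "\<dots> = vecm (transpose_mat X) $ l"
    using X b l by (simp add: k0_def vecm_def)
  finally show "(commut p p *\<^sub>v vecm X) $ l = vecm (transpose_mat X) $ l" .
qed

lemma commut_carrier [simp]: "commut m n \<in> carrier_mat (m * n) (m * n)"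
  by (simp add: commut_def)

lemma one_plus_commut_mult_vecm:
  assumes X: "X \<in> carrier_mat p p"
  shows "(1\<^sub>m (p*p) + commut p p) *\<^sub>v vecm X = vecm (X + transpose_mat X)"
  using X vecm_carrier[OF X]
  by (simp add: add_mult_distrib_mat_vec[of _ "p*p" "p*p"] commut_mult_vecm vecm_add[of _ p p])

lemma one_minus_commut_mult_vecm:
  assumes X: "X \<in> carrier_mat p p"
  shows "(1\<^sub>m (p*p) - commut p p) *\<^sub>v vecm X = vecm (X - transpose_mat X)"
  using X vecm_carrier[OF X]
  by (simp add: minus_mult_distrib_mat_vec[of _ "p*p" "p*p"] commut_mult_vecm vecm_diff[of _ p p])

section \<open>Half-vectorization and the duplication matrix\<close>

lemma vech_length: "(\<Sum>c<r. r - c) = r * (r + 1) div (2::nat)"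
proof -
  \<comment> \<open>Read in reverse order, the columns of the lower triangle have lengths 1 to
    \<open>r\<close>.\<close>
  have "(\<Sum>c<r. r - c) = (\<Sum>c<r. Suc c)"
    by (rule sum.reindex_bij_witness[of _ "\<lambda>c. r - Suc c" "\<lambda>c. r - Suc c"]) auto
  also have "\<dots> = r * (r + 1) div 2"
    by (induction r) auto
  finally show ?thesis .
qed

lemma vech_idx_less:
  assumes "j \<le> i" "i < r"
  shows "vech_idx r i j < r * (r + 1) div 2"
proof -
  have "vech_idx r i j < (\<Sum>c<Suc j. r - c)"
    using assms by (simp add: vech_idx_def)
  also have "\<dots> \<le> (\<Sum>c<r. r - c)"
    using assms by (intro sum_mono2) auto
  finally show ?thesis by (simp only: vech_length)
qed

text \<open>The columns of the lower triangle are laid out consecutively, column \<open>c\<close>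
  having \<open>r - c\<close> entries; induction on the number of columns finds the one that
  contains \<open>k\<close>.\<close>

lemma vech_idx_surj:
  assumes "k < r * (r + 1) div 2"
  obtains i j where "j \<le> i" "i < r" "vech_idx r i j = k"
proof -
  have "\<exists>i j. j \<le> i \<and> i < r \<and> vech_idx r i j = k" if "m \<le> r" "k < (\<Sum>c<m. r - c)" for m
    using that
  proof (induction m)
    case (Suc m)
    show ?case
    proof (cases "k < (\<Sum>c<m. r - c)")
      case True
      then show ?thesis using Suc by simp
    next
      case False
      \<comment> \<open>Column \<open>m\<close> starts at its diagonal entry, so the offset of
        \<open>k\<close> within the column is added to \<open>m\<close>.\<close>
      let ?i = "m + (k - (\<Sum>c<m. r - c))"
      have "m \<le> ?i" "?i < r" "vech_idx r ?i m = k"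
        using Suc.prems False by (auto simp: vech_idx_def)
      then show ?thesis by blast
    qed
  qed simp
  from this[of r] show thesis using assms that unfolding vech_length by blast
qed

lemma sym_of_carrier [simp]: "sym_of r \<mu> \<in> carrier_mat r r"
  by (simp add: sym_of_def)

lemma sym_of_symmetric: "transpose_mat (sym_of r \<mu>) = sym_of r \<mu>"
  by (auto simp: sym_of_def max.commute min.commute intro!: eq_matI)

lemma dup_carrier [simp]: "dup r \<in> carrier_mat (r * r) (r * (r + 1) div 2)"
  by (simp add: dup_def)

lemma dup_mult_vec:
  assumes w: "w \<in> carrier_vec (r * (r + 1) div 2)"
  shows "dup r *\<^sub>v w = vecm (sym_of r w)"
proof (rule eq_vecI)
  show "dim_vec (dup r *\<^sub>v w) = dim_vec (vecm (sym_of r w))"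
    by (simp add: dup_def vecm_def sym_of_def)
  fix k assume "k < dim_vec (vecm (sym_of r w))"
  then have k: "k < r * r" by (simp add: vecm_def sym_of_def)
  note b = vec_idx_bounds[OF k]
  let ?l = "vech_idx r (max (k mod r) (k div r)) (min (k mod r) (k div r))"
  have l: "?l < r * (r + 1) div 2" using b by (intro vech_idx_less) auto
  have "(dup r *\<^sub>v w) $ k = (\<Sum>l<r*(r+1) div 2. (if l = ?l then 1 else 0) * w $ l)"
    using w k by (simp add: dup_def scalar_prod_def atLeast0LessThan)
  also have "\<dots> = w $ ?l"
    using l by (simp add: if_distrib[of "\<lambda>x. x * _"] cong: if_cong)
  also have "\<dots> = vecm (sym_of r w) $ k"
    using k b by (simp add: vecm_def sym_of_def)
  finally show "(dup r *\<^sub>v w) $ k = vecm (sym_of r w) $ k" .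
qed

text \<open>Every coordinate of \<open>w\<close> occurs among the entries of the symmetric matrix,
  the off-diagonal ones twice, so the sum of squares cannot decrease.\<close>

lemma vnorm_le_fnorm_sym_of:
  assumes w: "w \<in> carrier_vec (r * (r + 1) div 2)"
  shows "vnorm w \<le> fnorm (sym_of r w)"
proof (rule power2_le_imp_le)
  let ?N = "r * (r + 1) div 2"
  let ?L = "{(j,i). j \<le> i \<and> i < r}"
  let ?f = "\<lambda>(j,i). vech_idx r i j"
  have fin: "finite ?L" by (rule finite_subset[of _ "{..<r} \<times> {..<r}"]) auto
  have "(vnorm w)\<^sup>2 = (\<Sum>k<?N. (w $ k)\<^sup>2)"
    unfolding vnorm_sq using w by (simp add: scalar_prod_def power2_eq_square atLeast0LessThan)
  also have "\<dots> \<le> (\<Sum>k\<in>?f ` ?L. (w $ k)\<^sup>2)"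
  proof (rule sum_mono2)
    show "{..<?N} \<subseteq> ?f ` ?L"
    proof
      fix k assume "k \<in> {..<?N}"
      then obtain i j where "j \<le> i" "i < r" "vech_idx r i j = k"
        by (meson lessThan_iff vech_idx_surj)
      then show "k \<in> ?f ` ?L" by force
    qed
  qed (use fin in auto)
  \<comment> \<open>A sum of nonnegative terms over an image is at most the sum over the index set,
    so surjectivity of the numbering is enough.\<close>
  also have "\<dots> \<le> (\<Sum>x\<in>?L. (w $ ?f x)\<^sup>2)"
    using sum_image_le[OF fin, of "\<lambda>k. (w $ k)\<^sup>2" ?f] by simp
  also have "\<dots> = (\<Sum>(j,i)\<in>?L. (sym_of r w $$ (i,j))\<^sup>2)"
    by (intro sum.cong) (auto simp: sym_of_def max_def min_def)
  also have "\<dots> \<le> (\<Sum>(j,i)\<in>{..<r} \<times> {..<r}. (sym_of r w $$ (i,j))\<^sup>2)"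
    by (intro sum_mono2) auto
  also have "\<dots> = (fnorm (sym_of r w))\<^sup>2"
    by (simp add: fnorm_sq[OF sym_of_carrier] sum.cartesian_product)
  finally show "(vnorm w)\<^sup>2 \<le> (fnorm (sym_of r w))\<^sup>2" .
qed simp

lemma hcat_carrier:
  "F \<in> carrier_mat m a \<Longrightarrow> G \<in> carrier_mat m b \<Longrightarrow> hcat F G \<in> carrier_mat m (a + b)"
  by (auto simp: hcat_def)

lemma hcat_mult_append:
  assumes F: "F \<in> carrier_mat m a" and G: "G \<in> carrier_mat m b"
    and v: "v \<in> carrier_vec a" and w: "w \<in> carrier_vec b"
  shows "hcat F G *\<^sub>v (v @\<^sub>v w) = F *\<^sub>v v + G *\<^sub>v w"
proof (rule eq_vecI)
  show "dim_vec (hcat F G *\<^sub>v (v @\<^sub>v w)) = dim_vec (F *\<^sub>v v + G *\<^sub>v w)"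
    using F G by (simp add: hcat_def)
  fix i assume "i < dim_vec (F *\<^sub>v v + G *\<^sub>v w)"
  then have i: "i < m" using G by simp
  have "row (hcat F G) i = row F i @\<^sub>v row G i"
    using F G i by (intro eq_vecI) (auto simp: hcat_def)
  then have "row (hcat F G) i \<bullet> (v @\<^sub>v w) = row F i \<bullet> v + row G i \<bullet> w"
    using scalar_prod_append[of "row F i" a "row G i" b v w] row_carrier_vec[OF i] F G v w i by auto
  then show "(hcat F G *\<^sub>v (v @\<^sub>v w)) $ i = (F *\<^sub>v v + G *\<^sub>v w) $ i"
    using F G i by (simp add: hcat_def)
qed

section \<open>Inverses\<close>

text \<open>\<open>minv\<close> takes \<open>the\<close> of an option, so the case
  \<open>None\<close> has to be excluded: a right inverse of a square matrix is two-sided and makes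
  \<open>G\<close> a unit.\<close>

lemma minv_eqI:
  assumes G: "G \<in> carrier_mat n n" and H: "H \<in> carrier_mat n n" and GH: "G * H = 1\<^sub>m n"
  shows "minv G = H"
proof (cases "mat_inverse G")
  case None
  have "H * G = 1\<^sub>m n" using mat_mult_left_right_inverse[OF G H GH] .
  then have "G \<in> Units (ring_mat TYPE(real) n ())"
    using G H GH by (auto simp: Units_def ring_mat_simps)
  then show ?thesis using mat_inverse(1)[OF G None, where b = "()"] by blast
next
  case (Some B)
  then have B: "B * G = 1\<^sub>m n" "B \<in> carrier_mat n n" using mat_inverse(2)[OF G Some] by auto
  have "B = B * (G * H)" using B GH by simp
  also have "\<dots> = H" using assoc_mult_mat[OF B(2) G H] B H by simp
  finally show ?thesis using Some by (simp add: minv_def)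
qed

text \<open>A positive lower bound on the stretching rules out a nonzero kernel vector, so the
  determinant does not vanish.\<close>

lemma expansive_inverse:
  assumes G: "(G :: real mat) \<in> carrier_mat n n"
    and c: "0 < c" and ge: "\<And>x. x \<in> carrier_vec n \<Longrightarrow> c * vnorm x \<le> vnorm (G *\<^sub>v x)"
  shows "minv G \<in> carrier_mat n n" "G * minv G = 1\<^sub>m n" "minv G * G = 1\<^sub>m n" "invertible_mat G"
proof -
  have "det G \<noteq> 0"
  proof
    assume "det G = 0"
    then obtain v where v: "v \<in> carrier_vec n" "v \<noteq> 0\<^sub>v n" "G *\<^sub>v v = 0\<^sub>v n"
      using det_0_iff_vec_prod_zero[OF G] by blast
    have "vnorm (0\<^sub>v n) = 0" using vnorm_eq_0_iff[of "0\<^sub>v n" n] by simp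
    then have "c * vnorm v \<le> 0" using ge[OF v(1)] v(3) by simp
    then have "vnorm v = 0" using c vnorm_nonneg[of v] by (simp add: mult_le_0_iff not_le)
    then show False using v vnorm_eq_0_iff by blast
  qed
  then have "G \<in> Units (ring_mat TYPE(real) n ())"
    by (rule det_non_zero_imp_unit[OF G])
  then obtain H where H: "H \<in> carrier_mat n n" "G * H = 1\<^sub>m n" "H * G = 1\<^sub>m n"
    by (auto simp: Units_def ring_mat_simps)
  have "minv G = H" using minv_eqI[OF G H(1,2)] .
  then show "minv G \<in> carrier_mat n n" "G * minv G = 1\<^sub>m n" "minv G * G = 1\<^sub>m n" "invertible_mat G"
    using H G by (auto simp: invertible_mat_def inverts_mat_def)
qed

lemma symmetric_inverse:
  fixes G :: "real mat"
  assumes G: "G \<in> carrier_mat n n" "transpose_mat G = G"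
    and H: "H \<in> carrier_mat n n" "G * H = 1\<^sub>m n" "H * G = 1\<^sub>m n"
  shows "transpose_mat H = H"
proof -
  have "G * transpose_mat H = 1\<^sub>m n"
    using transpose_mult[OF H(1) G(1)] H(3) G(2) by simp
  then have "minv G = transpose_mat H" using G H by (intro minv_eqI) auto
  moreover have "minv G = H" using G H by (intro minv_eqI)
  ultimately show ?thesis by simp
qed

text \<open>The form x . Gx = |x|^2 + |Ax|^2 dominates |x|^2, and Cauchy-Schwarz bounds it by |x|
  |Gx|. This is the input of \<open>expansive_inverse\<close> with constant 1.\<close>

lemma one_plus_gram:
  assumes A: "A \<in> carrier_mat m n"
  defines "G \<equiv> 1\<^sub>m n + transpose_mat A * A"
  shows "G \<in> carrier_mat n n" "transpose_mat G = G"
    and "\<And>x. x \<in> carrier_vec n \<Longrightarrow> vnorm x \<le> vnorm (G *\<^sub>v x)"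
proof -
  show G: "G \<in> carrier_mat n n" using A by (simp add: G_def)
  show "transpose_mat G = G"
    using gram_carrier[OF A] unfolding G_def by (subst transpose_add[of _ n n]) auto
  fix x :: "real vec" assume x: "x \<in> carrier_vec n"
  have "(vnorm x)\<^sup>2 \<le> (vnorm x)\<^sup>2 + (vnorm (A *\<^sub>v x))\<^sup>2" by simp
  also have "\<dots> = x \<bullet> (G *\<^sub>v x)"
    using x gram_carrier(1)[OF A] A unfolding vnorm_mult_sq[OF A x]
    by (simp add: G_def vnorm_sq add_mult_distrib_mat_vec[of _ n n] scalar_prod_add_distrib[of _ n])
  also have "\<dots> \<le> vnorm x * vnorm (G *\<^sub>v x)"
    using G x by (intro scalar_prod_le_vnorm) auto
  finally have "vnorm x * vnorm x \<le> vnorm x * vnorm (G *\<^sub>v x)" by (simp add: power2_eq_square)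
  then show "vnorm x \<le> vnorm (G *\<^sub>v x)"
    by (metis mult_le_cancel_left vnorm_nonneg order_le_less)
qed

lemma one_plus_gram_le:
  assumes A: "A \<in> carrier_mat m n" and a: "0 \<le> a"
    and le: "\<And>x. x \<in> carrier_vec n \<Longrightarrow> vnorm (A *\<^sub>v x) \<le> a * vnorm x"
    and le': "\<And>y. y \<in> carrier_vec m \<Longrightarrow> vnorm (transpose_mat A *\<^sub>v y) \<le> a * vnorm y"
    and x: "x \<in> carrier_vec n"
  shows "vnorm ((1\<^sub>m n + transpose_mat A * A) *\<^sub>v x) \<le> (1 + a\<^sup>2) * vnorm x"
proof -
  have Ax: "A *\<^sub>v x \<in> carrier_vec m" using A x by simp
  have "(1\<^sub>m n + transpose_mat A * A) *\<^sub>v x = x + transpose_mat A *\<^sub>v (A *\<^sub>v x)"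
    using A x by (simp add: add_mult_distrib_mat_vec[of _ n n])
  also have "vnorm \<dots> \<le> vnorm x + vnorm (transpose_mat A *\<^sub>v (A *\<^sub>v x))"
    using A x by (intro vnorm_triangle[of _ n]) auto
  also have "vnorm (transpose_mat A *\<^sub>v (A *\<^sub>v x)) \<le> a * (a * vnorm x)"
    using le'[OF Ax] mult_left_mono[OF le[OF x] a] by linarith
  finally show ?thesis by (simp add: power2_eq_square algebra_simps)
qed

section \<open>The Cayley parameterization\<close>

lemma invertible_commuting:
  fixes P R C :: "real mat"
  assumes P: "P \<in> carrier_mat n n" and R: "R \<in> carrier_mat n n" and C: "C \<in> carrier_mat n n"
    and PC: "P * C = 1\<^sub>m n" and CP: "C * P = 1\<^sub>m n" and comm: "P * R = R * P"
  shows "R * C = C * R"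
proof -
  have "R * C = (C * P) * (R * C)" using CP R C by simp
  also have "\<dots> = C * ((P * R) * C)" using P R C by (simp add: assoc_mult_mat[of _ n n _ n _ n])
  also have "\<dots> = (C * R) * (P * C)" unfolding comm using P R C
    by (simp add: assoc_mult_mat[of _ n n _ n _ n])
  also have "\<dots> = C * R" using PC R C by simp
  finally show ?thesis .
qed

text \<open>With P = I - X and R = I + X, skewness gives P^T = R, so C^T inverts R. Since P and R
  commute, so do C and R, and the factors of Q^T Q cancel. The second claim rests on Q C^T = R C C^T
  = C R C^T = C; it extracts \<open>Q\<close> from the derivative of the Cayley transform.\<close>

lemma cayley_orthogonal:
  fixes X C :: "real mat"
  assumes X: "X \<in> carrier_mat n n" and skew: "transpose_mat X = - X" and C: "C \<in> carrier_mat n n"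
    and inv: "(1\<^sub>m n - X) * C = 1\<^sub>m n" "C * (1\<^sub>m n - X) = 1\<^sub>m n"
  defines "Q \<equiv> (1\<^sub>m n + X) * C"
  shows "transpose_mat Q * Q = 1\<^sub>m n"
    and "Y \<in> carrier_mat n n \<Longrightarrow> Q * (transpose_mat C * Y * C) = C * Y * C"
proof -
  define P where "P = 1\<^sub>m n - X"
  define R where "R = 1\<^sub>m n + X"
  have P: "P \<in> carrier_mat n n" and R: "R \<in> carrier_mat n n" using X by (auto simp: P_def R_def)
  have PC: "P * C = 1\<^sub>m n" and CP: "C * P = 1\<^sub>m n" using inv by (auto simp: P_def)
  have Pt: "transpose_mat P = R"
  proof -
    have "transpose_mat P = 1\<^sub>m n - transpose_mat X"
      using X by (intro eq_matI) (auto simp: P_def)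
    also have "\<dots> = R" unfolding skew R_def using X by (intro eq_matI) auto
    finally show ?thesis .
  qed
  have Rt: "transpose_mat R = P" using Pt by (metis transpose_transpose)
  have comm: "P * R = R * P"
  proof -
    have "P * R = R - (X + X * X)"
      unfolding P_def minus_mult_distrib_mat[OF one_carrier_mat X R]
      using X R mult_add_distrib_mat[OF X one_carrier_mat X] by (simp add: R_def)
    moreover have "R * P = P + (X - X * X)"
      unfolding R_def add_mult_distrib_mat[OF one_carrier_mat X P]
      using X P mult_minus_distrib_mat[OF X one_carrier_mat X] by (simp add: P_def)
    ultimately show ?thesis using X mult_carrier_mat[OF X X] unfolding P_def R_def
      by (auto intro!: eq_matI simp del: index_mult_mat(1))
  qed
  have RC: "R * C = C * R" by (rule invertible_commuting[OF P R C PC CP comm])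
  have Ct: "transpose_mat C \<in> carrier_mat n n" using C by simp
  have RCt: "R * transpose_mat C = 1\<^sub>m n" and CtR: "transpose_mat C * R = 1\<^sub>m n"
    unfolding Pt[symmetric] transpose_mult[OF C P, symmetric] transpose_mult[OF P C, symmetric] CP PC
    by simp_all
  note assoc = assoc_mult_mat[of _ n n _ n _ n]
  have Qt: "transpose_mat Q = transpose_mat C * P"
    using transpose_mult[OF R C] Rt by (simp add: Q_def R_def)
  have "transpose_mat Q * Q = transpose_mat C * (P * R) * C"
    unfolding Qt using P R C Ct by (simp add: assoc Q_def R_def[symmetric])
  also have "\<dots> = (transpose_mat C * R) * (P * C)"
    unfolding comm using P R C Ct by (simp add: assoc)
  finally show "transpose_mat Q * Q = 1\<^sub>m n" using CtR PC by simp
  assume Y: "Y \<in> carrier_mat n n"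
  have "Q * (transpose_mat C * Y * C) = (R * C) * transpose_mat C * (Y * C)"
    using R C Ct Y by (simp add: assoc Q_def R_def[symmetric])
  also have "\<dots> = C * (R * transpose_mat C) * (Y * C)"
    unfolding RC using R C Ct Y by (simp add: assoc)
  also have "\<dots> = C * Y * C" unfolding RCt using C Y by (simp add: assoc)
  finally show "Q * (transpose_mat C * Y * C) = C * Y * C" .
qed

section \<open>Block selectors and the matrix Gamma\<close>

lemma Xmat_carrier: "B \<in> carrier_mat q r \<Longrightarrow> Xmat (r + q) r B \<in> carrier_mat (r + q) (r + q)"
  by (auto simp: Xmat_def)

lemma Xmat_skew: "B \<in> carrier_mat q r \<Longrightarrow> transpose_mat (Xmat (r + q) r B) = - Xmat (r + q) r B"
  by (auto simp: Xmat_def intro!: eq_matI)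

lemma Ipr_carrier [simp]: "Ipr p r \<in> carrier_mat p r"
  by (simp add: Ipr_def)

lemma Theta2_carrier: "Theta2 (r + q) r \<in> carrier_mat q (r + q)"
  by (intro carrier_matI) (simp_all add: Theta2_def)

lemma mult_Ipr_transpose:
  assumes Y: "Y \<in> carrier_mat m r"
  shows "Y * transpose_mat (Ipr (r + q) r) = mat m (r + q) (\<lambda>(i,j). if j < r then Y $$ (i,j) else 0)"
  using Y by (intro eq_matI)
    (auto simp: Ipr_def scalar_prod_def if_distrib[of "\<lambda>x. _ * x"] cong: if_cong)

lemma Ipr_mult:
  assumes N: "N \<in> carrier_mat r k"
  shows "Ipr (r + q) r * N = mat (r + q) k (\<lambda>(i,j). if i < r then N $$ (i,j) else 0)"
  using N by (intro eq_matI)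
    (auto simp: Ipr_def scalar_prod_def if_distrib[of "\<lambda>x. x * _"] cong: if_cong)

lemma Theta2_transpose_mult:
  assumes B: "B \<in> carrier_mat q k"
  shows "transpose_mat (Theta2 (r + q) r) * B =
      mat (r + q) k (\<lambda>(i,j). if i < r then 0 else B $$ (i - r,j))"
  using B by (intro eq_matI) (auto simp: Theta2_def scalar_prod_def one_mat_def
      if_distrib[of "\<lambda>x. x * _"] cong: if_cong)

lemma Ipr_sandwich:
  assumes N: "N \<in> carrier_mat r r"
  shows "Ipr (r + q) r * N * transpose_mat (Ipr (r + q) r) =
    four_block_mat N (0\<^sub>m r q) (0\<^sub>m q r) (0\<^sub>m q q)"
  unfolding Ipr_mult[OF N] mult_Ipr_transpose[OF mat_carrier] using N by (intro eq_matI) auto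

lemma Theta_sandwich:
  assumes B: "B \<in> carrier_mat q r"
  shows "transpose_mat (Theta2 (r + q) r) * B * Theta1 (r + q) r =
    four_block_mat (0\<^sub>m r r) (0\<^sub>m r q) B (0\<^sub>m q q)"
  unfolding Theta1_def Theta2_transpose_mult[OF B] mult_Ipr_transpose[OF mat_carrier]
  using B by (intro eq_matI) auto

lemma Gam_carrier: "Gam (r + q) r \<in> carrier_mat ((r + q) * (r + q)) (r * q)"
proof -
  have "kron (transpose_mat (Theta1 (r + q) r)) (transpose_mat (Theta2 (r + q) r))
      \<in> carrier_mat ((r + q) * (r + q)) (r * q)"
    using Theta2_carrier[of r q] by (intro kron_carrier) (auto simp: Theta1_def)
  then show ?thesis
    unfolding Gam_def by (rule mult_carrier_mat[OF minus_carrier_mat[OF commut_carrier]])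
qed

text \<open>The Kronecker factor places \<open>B\<close> in the lower left block, and I - K
  subtracts the transpose, which yields the skew matrix.\<close>

lemma Gam_mult_vecm:
  assumes B: "B \<in> carrier_mat q r"
  shows "Gam (r + q) r *\<^sub>v vecm B = vecm (Xmat (r + q) r B)"
proof -
  let ?p = "r + q"
  let ?L = "four_block_mat (0\<^sub>m r r) (0\<^sub>m r q) B (0\<^sub>m q q)"
  let ?K = "kron (transpose_mat (Theta1 ?p r)) (transpose_mat (Theta2 ?p r))"
  have L: "?L \<in> carrier_mat ?p ?p" using B by simp
  have T1: "transpose_mat (Theta1 ?p r) \<in> carrier_mat ?p r"
    by (simp add: Theta1_def)
  have T2: "transpose_mat (Theta2 ?p r) \<in> carrier_mat ?p q"
    using Theta2_carrier[of r q] by simp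
  have K: "?K \<in> carrier_mat (?p * ?p) (q * r)"
    using kron_carrier[OF T1 T2] by (simp only: mult.commute)
  have "?K *\<^sub>v vecm B = vecm ?L"
    by (simp only: kron_mult_vecm[OF T1 T2 B] transpose_transpose Theta_sandwich[OF B])
  moreover have "Gam ?p r *\<^sub>v vecm B = (1\<^sub>m (?p*?p) - commut ?p ?p) *\<^sub>v (?K *\<^sub>v vecm B)"
    unfolding Gam_def
    by (rule assoc_mult_mat_vec[OF minus_carrier_mat[OF commut_carrier] K vecm_carrier[OF B]])
  ultimately have "Gam ?p r *\<^sub>v vecm B = (1\<^sub>m (?p*?p) - commut ?p ?p) *\<^sub>v vecm ?L"
    by (simp only:)
  also have "\<dots> = vecm (?L - transpose_mat ?L)"
    by (rule one_minus_commut_mult_vecm[OF L])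
  also have "?L - transpose_mat ?L = Xmat ?p r B"
  proof (rule eq_matI)
    fix i j assume "i < dim_row (Xmat ?p r B)" "j < dim_col (Xmat ?p r B)"
    then have "i < ?p" "j < ?p" using B by (auto simp: Xmat_def)
    then show "(?L - transpose_mat ?L) $$ (i,j) = Xmat ?p r B $$ (i,j)"
      using B by (cases "i < r"; cases "j < r"; simp add: Xmat_def)
  qed (use B in \<open>simp_all add: Xmat_def\<close>)
  finally show ?thesis .
qed

lemma uminus_mult_mat:
  fixes P R :: "real mat"
  assumes "P \<in> carrier_mat n k" "R \<in> carrier_mat k m"
  shows "P * - R = - (P * R)" "- P * R = - (P * R)" "- P * - R = P * R"
  using assms by simp_all

lemma smult_mat_mult_vec:
  fixes M :: "real mat"
  assumes "M \<in> carrier_mat m n" "v \<in> carrier_vec n"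
  shows "(c \<cdot>\<^sub>m M) *\<^sub>v v = c \<cdot>\<^sub>v (M *\<^sub>v v)"
  using assms by (intro eq_vecI) auto

lemma transpose_scalar_mat:
  assumes "Y \<in> carrier_mat 1 1"
  shows "transpose_mat Y = Y"
  using assms by (intro eq_matI) auto

text \<open>The base point is fixed while directions \<open>B\<close> vary. Writing p as
  \<open>r + q\<close> keeps truncated subtraction out of the block sizes.\<close>

locale cayley_point =
  fixes r q :: nat and A :: "real mat"
  assumes A: "A \<in> carrier_mat q r"
begin

definition "S = minv (1\<^sub>m r + transpose_mat A * A)"
definition "T = minv (1\<^sub>m q + A * transpose_mat A)"
definition "C = minv (1\<^sub>m (r + q) - Xmat (r + q) r A)"
definition "Q = (1\<^sub>m (r + q) + Xmat (r + q) r A) * C"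

lemma At: "transpose_mat A \<in> carrier_mat r q"
  using A by simp

lemma S:
  "S \<in> carrier_mat r r" "(1\<^sub>m r + transpose_mat A * A) * S = 1\<^sub>m r"
  "S * (1\<^sub>m r + transpose_mat A * A) = 1\<^sub>m r" "transpose_mat S = S"
proof -
  note G = one_plus_gram[OF A]
  show S: "S \<in> carrier_mat r r" "(1\<^sub>m r + transpose_mat A * A) * S = 1\<^sub>m r"
    "S * (1\<^sub>m r + transpose_mat A * A) = 1\<^sub>m r"
    unfolding S_def using expansive_inverse(1-3)[OF G(1), of 1] G(3) by simp_all
  show "transpose_mat S = S" using symmetric_inverse[OF G(1,2) S] .
qed

lemma T:
  "T \<in> carrier_mat q q" "(1\<^sub>m q + A * transpose_mat A) * T = 1\<^sub>m q"
  "T * (1\<^sub>m q + A * transpose_mat A) = 1\<^sub>m q" "transpose_mat T = T"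
proof -
  note G = one_plus_gram[OF At, unfolded transpose_transpose]
  show T: "T \<in> carrier_mat q q" "(1\<^sub>m q + A * transpose_mat A) * T = 1\<^sub>m q"
    "T * (1\<^sub>m q + A * transpose_mat A) = 1\<^sub>m q"
    unfolding T_def using expansive_inverse(1-3)[OF G(1), of 1] G(3) by simp_all
  show "transpose_mat T = T" using symmetric_inverse[OF G(1,2) T] .
qed

text \<open>The inverse of an expansion is a contraction.\<close>

lemma vnorm_S_le: "x \<in> carrier_vec r \<Longrightarrow> vnorm (S *\<^sub>v x) \<le> vnorm x"
proof -
  assume x: "x \<in> carrier_vec r"
  have Sx: "S *\<^sub>v x \<in> carrier_vec r" using S(1) x by simp
  have "x = (1\<^sub>m r + transpose_mat A * A) *\<^sub>v (S *\<^sub>v x)"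
    using assoc_mult_mat_vec[OF one_plus_gram(1)[OF A] S(1) x] S(2) x by simp
  then show ?thesis using one_plus_gram(3)[OF A Sx] by simp
qed

text \<open>Checked by block multiplication: the diagonal blocks reduce to the defining equations of
  \<open>S\<close> and \<open>T\<close>, and the off-diagonal blocks cancel. Uniqueness of the
  inverse then identifies the candidate with \<open>C\<close>.\<close>

lemma C_block:
  defines "C' \<equiv> four_block_mat S (- (transpose_mat A * T)) (A * S) T"
  shows "C = C'" "(1\<^sub>m (r + q) - Xmat (r + q) r A) * C = 1\<^sub>m (r + q)"
    "C * (1\<^sub>m (r + q) - Xmat (r + q) r A) = 1\<^sub>m (r + q)" "C \<in> carrier_mat (r + q) (r + q)"
proof -
  let ?P = "1\<^sub>m (r + q) - Xmat (r + q) r A"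
  have P: "?P \<in> carrier_mat (r + q) (r + q)" using Xmat_carrier[OF A] by (rule minus_carrier_mat)
  have C': "C' \<in> carrier_mat (r + q) (r + q)"
    unfolding C'_def by (rule four_block_carrier_mat[OF S(1) T(1)])
  have AS: "A * S \<in> carrier_mat q r" and AT: "transpose_mat A * T \<in> carrier_mat r q"
    using A S(1) T(1) by auto
  have Pb: "?P = four_block_mat (1\<^sub>m r) (transpose_mat A) (- A) (1\<^sub>m q)"
  proof (rule eq_matI)
    fix i j assume "i < dim_row (four_block_mat (1\<^sub>m r) (transpose_mat A) (- A) (1\<^sub>m q))"
      "j < dim_col (four_block_mat (1\<^sub>m r) (transpose_mat A) (- A) (1\<^sub>m q))"
    then have "i < r + q" "j < r + q" by auto
    then show "?P $$ (i,j) = four_block_mat (1\<^sub>m r) (transpose_mat A) (- A) (1\<^sub>m q) $$ (i,j)"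
      using A by (cases "i < r"; cases "j < r"; auto simp add: Xmat_def)
  qed (use A in \<open>simp_all add: Xmat_def\<close>)
  have 1: "1\<^sub>m r * S + transpose_mat A * (A * S) = 1\<^sub>m r"
    using add_mult_distrib_mat[OF one_carrier_mat gram_carrier(1)[OF A] S(1)] S(2)
      assoc_mult_mat[OF At A S(1)] by simp
  have 2: "1\<^sub>m r * (- (transpose_mat A * T)) + transpose_mat A * T = 0\<^sub>m r q"
    using AT left_mult_one_mat[of "- (transpose_mat A * T)" r q] uminus_l_inv_mat[OF AT] by simp
  have 3: "- A * S + 1\<^sub>m q * (A * S) = 0\<^sub>m q r"
    using AS left_mult_one_mat[OF AS] uminus_l_inv_mat[OF AS] uminus_mult_left_mat[of A S] A S(1) by simp
  have 4: "- A * (- (transpose_mat A * T)) + 1\<^sub>m q * T = 1\<^sub>m q"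
  proof -
    have AAT: "A * (transpose_mat A * T) \<in> carrier_mat q q" using A T(1) by simp
    have "- A * (- (transpose_mat A * T)) = A * (transpose_mat A * T)"
      using A T(1) by simp
    then have "- A * (- (transpose_mat A * T)) + 1\<^sub>m q * T = 1\<^sub>m q * T + A * transpose_mat A * T"
      using AAT T(1) comm_add_mat[of T q q] assoc_mult_mat[OF A At T(1)] by simp
    also have "\<dots> = 1\<^sub>m q"
      using add_mult_distrib_mat[OF one_carrier_mat _ T(1), of "A * transpose_mat A"] T(2) A by simp
    finally show ?thesis .
  qed
  have PC': "?P * C' = 1\<^sub>m (r + q)"
    unfolding Pb C'_def
    by (subst mult_four_block_mat[OF one_carrier_mat At uminus_carrier_mat[OF A] one_carrier_mat S(1)
        uminus_carrier_mat[OF AT] AS T(1)]) (simp only: 1 2 3 4 four_block_one_mat)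
  show CC: "C = C'" unfolding C_def by (rule minv_eqI[OF P C' PC'])
  show "?P * C = 1\<^sub>m (r + q)" "C \<in> carrier_mat (r + q) (r + q)" using PC' C' CC by auto
  show "C * ?P = 1\<^sub>m (r + q)" unfolding CC by (rule mat_mult_left_right_inverse[OF P C' PC'])
qed

lemmas C = C_block(4)
lemmas X = Xmat_carrier[OF A]

lemma Q: "Q \<in> carrier_mat (r + q) (r + q)" "transpose_mat Q * Q = 1\<^sub>m (r + q)"
  unfolding Q_def using cayley_orthogonal(1)[OF X Xmat_skew[OF A] C C_block(2,3)] X C by auto

section \<open>The direction conjugated by C and bounds on its first block column\<close>

definition "W B = T * ((B + A * (transpose_mat B * A)) * S)"
definition "V B = S * ((transpose_mat A * B - transpose_mat B * A) * S)"

text \<open>The second block column is left unspecified because multiplication by diag(M, 0) later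
  annihilates it.\<close>

lemma conjugated_direction:
  assumes B: "B \<in> carrier_mat q r"
  obtains V12 V22 where "V12 \<in> carrier_mat r q" "V22 \<in> carrier_mat q q"
    "transpose_mat C * Xmat (r + q) r B * C = four_block_mat (V B) V12 (W B) V22"
proof -
  have Bt: "transpose_mat B \<in> carrier_mat r q" using B by simp
  have AS: "A * S \<in> carrier_mat q r" and AT: "transpose_mat A * T \<in> carrier_mat r q"
    using A S(1) T(1) by auto
  have BAS: "transpose_mat B * (A * S) \<in> carrier_mat r r" using Bt AS by simp
  have BA: "transpose_mat B * A \<in> carrier_mat r r" using Bt A by simp
  have BS: "B * S \<in> carrier_mat q r" using B S(1) by simp
  have Ct: "transpose_mat C = four_block_mat S (S * transpose_mat A) (- (T * A)) T"
  proof -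
    have "transpose_mat (A * S) = S * transpose_mat A"
      using transpose_mult[OF A S(1)] S(4) by simp
    moreover have "transpose_mat (- (transpose_mat A * T)) = - (T * A)"
      using transpose_mult[OF At T(1)] T(4) by (simp add: transpose_uminus)
    ultimately show ?thesis
      unfolding C_block(1)
      by (simp add: transpose_four_block_mat[OF S(1) uminus_carrier_mat[OF AT] AS T(1)] S(4) T(4))
  qed
  have XC: "Xmat (r + q) r B * C = four_block_mat
      (0\<^sub>m r r * S + - transpose_mat B * (A * S)) (0\<^sub>m r r * (- (transpose_mat A * T)) + - transpose_mat B * T)
      (B * S + 0\<^sub>m q q * (A * S)) (B * (- (transpose_mat A * T)) + 0\<^sub>m q q * T)"
    unfolding C_block(1) Xmat_def
    using mult_four_block_mat[OF zero_carrier_mat uminus_carrier_mat[OF Bt] B zero_carrier_mat S(1)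
        uminus_carrier_mat[OF AT] AS T(1)] by simp
  have e1: "0\<^sub>m r r * S + - transpose_mat B * (A * S) = - (transpose_mat B * (A * S))"
    using uminus_carrier_mat[OF BAS] S(1) AS B uminus_mult_left_mat[of "transpose_mat B" "A * S"] by auto
  have e2: "B * S + 0\<^sub>m q q * (A * S) = B * S"
    using left_mult_zero_mat[OF AS] right_add_zero_mat[OF BS] by simp
  define Y12 where "Y12 = 0\<^sub>m r r * (- (transpose_mat A * T)) + - transpose_mat B * T"
  define Y22 where "Y22 = B * (- (transpose_mat A * T)) + 0\<^sub>m q q * T"
  have Y: "Y12 \<in> carrier_mat r q" "Y22 \<in> carrier_mat q q"
    unfolding Y12_def Y22_def using Bt T(1) B AT by (intro add_carrier_mat; auto)+
  have XC': "Xmat (r + q) r B * C = four_block_mat (- (transpose_mat B * (A * S))) Y12 (B * S) Y22"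
    unfolding XC e1 e2 Y12_def Y22_def ..
  have SAt: "S * transpose_mat A \<in> carrier_mat r q" and TA: "T * A \<in> carrier_mat q r"
    using A S(1) T(1) by auto
  have "transpose_mat C * Xmat (r + q) r B * C = transpose_mat C * (Xmat (r + q) r B * C)"
    using C Xmat_carrier[OF B] by (intro assoc_mult_mat) auto
  also have "\<dots> = four_block_mat
      (S * (- (transpose_mat B * (A * S))) + S * transpose_mat A * (B * S))
      (S * Y12 + S * transpose_mat A * Y22)
      (- (T * A) * (- (transpose_mat B * (A * S))) + T * (B * S))
      (- (T * A) * Y12 + T * Y22)"
    unfolding Ct XC'
    by (rule mult_four_block_mat[OF S(1) SAt uminus_carrier_mat[OF TA] T(1)
        uminus_carrier_mat[OF BAS] Y(1) BS Y(2)])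
  also have "S * (- (transpose_mat B * (A * S))) + S * transpose_mat A * (B * S) = V B"
  proof -
    have AtB: "transpose_mat A * B \<in> carrier_mat r r" using At B by simp
    have "V B = S * (transpose_mat A * B * S - transpose_mat B * A * S)"
      unfolding V_def minus_mult_distrib_mat[OF AtB BA S(1)] ..
    also have "\<dots> = S * (transpose_mat A * B * S) - S * (transpose_mat B * A * S)"
      by (rule mult_minus_distrib_mat[OF S(1) mult_carrier_mat[OF AtB S(1)] mult_carrier_mat[OF BA S(1)]])
    also have "\<dots> = S * transpose_mat A * (B * S) - S * (transpose_mat B * (A * S))"
      by (simp only: assoc_mult_mat[OF At B S(1)] assoc_mult_mat[OF Bt A S(1)] assoc_mult_mat[OF S(1) At BS])
    finally have VB: "V B = S * transpose_mat A * (B * S) - S * (transpose_mat B * (A * S))" .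
    have m: "S * (- (transpose_mat B * (A * S))) = - (S * (transpose_mat B * (A * S)))"
      by (rule uminus_mult_mat(1)[OF S(1) BAS])
    have c1: "S * transpose_mat A * (B * S) \<in> carrier_mat r r" using SAt BS by (rule mult_carrier_mat)
    have c2: "S * (transpose_mat B * (A * S)) \<in> carrier_mat r r" using S(1) BAS by (rule mult_carrier_mat)
    show ?thesis unfolding VB m
      using comm_add_mat[OF uminus_carrier_mat[OF c2] c1] add_uminus_minus_mat[OF c1 c2] by simp
  qed
  also have "- (T * A) * (- (transpose_mat B * (A * S))) + T * (B * S) = W B"
  proof -
    have ABA: "A * (transpose_mat B * A) \<in> carrier_mat q r" using A BA by simp
    have "W B = T * (B * S + A * (transpose_mat B * A) * S)"
      unfolding W_def add_mult_distrib_mat[OF B ABA S(1)] ..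
    also have "\<dots> = T * (B * S) + T * (A * (transpose_mat B * A) * S)"
      by (rule mult_add_distrib_mat[OF T(1) BS mult_carrier_mat[OF ABA S(1)]])
    also have "T * (A * (transpose_mat B * A) * S) = T * A * (transpose_mat B * (A * S))"
      by (simp only: assoc_mult_mat[OF A BA S(1)] assoc_mult_mat[OF Bt A S(1)] assoc_mult_mat[OF T(1) A BAS])
    finally have WB: "W B = T * (B * S) + T * A * (transpose_mat B * (A * S))" .
    have m: "- (T * A) * (- (transpose_mat B * (A * S))) = T * A * (transpose_mat B * (A * S))"
      by (rule uminus_mult_mat(3)[OF TA BAS])
    have c1: "T * (B * S) \<in> carrier_mat q r" using T(1) BS by (rule mult_carrier_mat)
    have c2: "T * A * (transpose_mat B * (A * S)) \<in> carrier_mat q r" using TA BAS by (rule mult_carrier_mat)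
    show ?thesis unfolding WB m by (rule comm_add_mat[OF c2 c1])
  qed
  finally show thesis
    by (rule that[rotated 2]) (use S(1) SAt T(1) TA Y in \<open>auto intro!: add_carrier_mat\<close>)
qed

lemma V_W_carrier:
  assumes B: "B \<in> carrier_mat q r"
  shows "V B \<in> carrier_mat r r" "W B \<in> carrier_mat q r"
  unfolding V_def W_def using A B S(1) T(1) by auto

text \<open>\<open>S\<close> is a contraction on either side, and the two terms of the difference
  are transposes of each other, each of norm at most \<open>a * fnorm B\<close> with
  \<open>a\<close> at most 1.\<close>

lemma fnorm_V_le:
  assumes B: "B \<in> carrier_mat q r" and a: "0 \<le> a" "a \<le> 1"
    and At_le: "\<And>y. y \<in> carrier_vec q \<Longrightarrow> vnorm (transpose_mat A *\<^sub>v y) \<le> a * vnorm y"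
  shows "fnorm (V B) \<le> 2 * fnorm B"
proof -
  have AtB: "transpose_mat A * B \<in> carrier_mat r r" using At B by simp
  have BA: "transpose_mat B * A \<in> carrier_mat r r" using A B by simp
  have BA': "transpose_mat B * A = transpose_mat (transpose_mat A * B)"
    using transpose_mult[OF At B] by simp
  let ?D = "transpose_mat A * B - transpose_mat B * A"
  have D: "?D \<in> carrier_mat r r" using BA by (rule minus_carrier_mat)
  have "fnorm (V B) \<le> 1 * fnorm (?D * S)"
    unfolding V_def
    by (rule fnorm_mult_le[OF S(1) mult_carrier_mat[OF D S(1)]]) (use vnorm_S_le in auto)
  also have "fnorm (?D * S) \<le> 1 * fnorm ?D"
    by (rule fnorm_mult_right_le[OF S(1) D]) (use vnorm_S_le S(4) in auto)
  also have "fnorm ?D \<le> fnorm (transpose_mat A * B) + fnorm (transpose_mat B * A)"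
    by (rule fnorm_diff_triangle[OF AtB BA])
  also have "fnorm (transpose_mat B * A) = fnorm (transpose_mat A * B)"
    unfolding BA' fnorm_transpose ..
  also have "fnorm (transpose_mat A * B) \<le> a * fnorm B"
    by (rule fnorm_mult_le[OF At B a(1) At_le])
  also have "a * fnorm B \<le> 1 * fnorm B"
    using a by (intro mult_right_mono) auto
  finally show ?thesis by simp
qed

context
  fixes a :: real
  assumes a: "0 \<le> a"
    and A_le: "\<And>x. x \<in> carrier_vec r \<Longrightarrow> vnorm (A *\<^sub>v x) \<le> a * vnorm x"
    and At_le: "\<And>y. y \<in> carrier_vec q \<Longrightarrow> vnorm (transpose_mat A *\<^sub>v y) \<le> a * vnorm y"
begin

text \<open>Undoing \<open>T\<close> and \<open>S\<close> by their inverses, each of norm at most 1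
  + a^2, leaves Z = B + A B^T A. The second term of Z has norm at most a^2 |B|, so |Z| is at least
  (1 - a^2) |B|.\<close>

lemma fnorm_W_ge_general:
  assumes B: "B \<in> carrier_mat q r"
  shows "(1 - a\<^sup>2) * fnorm B \<le> (1 + a\<^sup>2)\<^sup>2 * fnorm (W B)"
proof -
  note W = V_W_carrier(2)[OF B]
  have Bt: "transpose_mat B \<in> carrier_mat r q" using B by simp
  let ?G = "1\<^sub>m r + transpose_mat A * A" and ?H = "1\<^sub>m q + A * transpose_mat A"
  note G = one_plus_gram(1,2)[OF A]
  note H = one_plus_gram(1)[OF At, unfolded transpose_transpose]
  have BA: "transpose_mat B * A \<in> carrier_mat r r" using A B by simp
  have ABA: "A * (transpose_mat B * A) \<in> carrier_mat q r" using A BA by simp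
  let ?Z = "B + A * (transpose_mat B * A)"
  have Z: "?Z \<in> carrier_mat q r" using ABA by simp
  have ZS: "?Z * S \<in> carrier_mat q r" using Z S(1) by (rule mult_carrier_mat)
  have "?H * W B = ?Z * S"
    unfolding W_def assoc_mult_mat[OF H T(1) ZS, symmetric] T(2) using ZS by (rule left_mult_one_mat)
  then have ZHW: "?Z = ?H * W B * ?G"
    using assoc_mult_mat[OF Z S(1) G(1)] S(3) right_mult_one_mat[OF Z] by simp
  have "fnorm ?Z \<le> (1 + a\<^sup>2) * fnorm (?H * W B)"
    unfolding ZHW
    by (rule fnorm_mult_right_le[OF G(1) mult_carrier_mat[OF H W]])
      (use one_plus_gram_le[OF A a A_le At_le] G(2) in auto)
  also have "fnorm (?H * W B) \<le> (1 + a\<^sup>2) * fnorm (W B)"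
    using one_plus_gram_le[OF At a At_le] A_le
    by (intro fnorm_mult_le[OF H W]) auto
  finally have Zle: "fnorm ?Z \<le> (1 + a\<^sup>2)\<^sup>2 * fnorm (W B)"
    by (simp add: power2_eq_square[of "1 + a\<^sup>2"] mult.assoc mult_left_mono)
  have "fnorm (A * (transpose_mat B * A)) \<le> a * fnorm (transpose_mat B * A)"
    by (rule fnorm_mult_le[OF A BA a A_le])
  also have "fnorm (transpose_mat B * A) \<le> a * fnorm (transpose_mat B)"
    by (rule fnorm_mult_right_le[OF A Bt a At_le])
  finally have ABA_le: "fnorm (A * (transpose_mat B * A)) \<le> a\<^sup>2 * fnorm B"
    using a by (simp add: fnorm_transpose power2_eq_square mult.assoc mult_left_mono)
  have "fnorm B \<le> fnorm ?Z + fnorm (A * (transpose_mat B * A))"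
    using fnorm_diff_triangle[OF Z ABA] unfolding add_diff_cancel_mat(1)[OF B ABA] .
  with Zle ABA_le show ?thesis by (simp add: algebra_simps)
qed

text \<open>For \<open>r = 1\<close> the scalar \<open>B\<^sup>T A\<close> is its own transpose, so
  \<open>B + A B\<^sup>T A = (I + A A\<^sup>T) B\<close> and the factor \<open>T\<close> cancels.\<close>

lemma fnorm_W_ge_column:
  assumes B: "B \<in> carrier_mat q r" and r: "r = 1"
  shows "fnorm B \<le> (1 + a\<^sup>2) * fnorm (W B)"
proof -
  note W = V_W_carrier(2)[OF B]
  let ?G = "1\<^sub>m r + transpose_mat A * A" and ?H = "1\<^sub>m q + A * transpose_mat A"
  note G = one_plus_gram(1,2)[OF A]
  note H = one_plus_gram(1)[OF At, unfolded transpose_transpose]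
  have BA: "transpose_mat B * A \<in> carrier_mat r r" using A B by simp
  have BS: "B * S \<in> carrier_mat q r" using B S(1) by (rule mult_carrier_mat)
  have "transpose_mat B * A = transpose_mat (transpose_mat B * A)"
    using transpose_scalar_mat[of "transpose_mat B * A"] BA r by simp
  also have "\<dots> = transpose_mat A * B"
    using transpose_mult[of "transpose_mat B" r q A r] A B by simp
  finally have "B + A * (transpose_mat B * A) = B + A * transpose_mat A * B"
    using assoc_mult_mat[OF A At B] by simp
  also have "\<dots> = ?H * B"
    using add_mult_distrib_mat[OF one_carrier_mat mult_carrier_mat[OF A At] B] B by simp
  finally have "W B = T * (?H * (B * S))"
    unfolding W_def using assoc_mult_mat[OF H B S(1)] by simp
  also have "\<dots> = B * S"
    using assoc_mult_mat[OF T(1) H BS] T(3) left_mult_one_mat[OF BS] by simp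
  finally have "W B * ?G = B"
    using assoc_mult_mat[OF B S(1) G(1)] S(3) right_mult_one_mat[OF B] by simp
  moreover have "fnorm (W B * ?G) \<le> (1 + a\<^sup>2) * fnorm (W B)"
    by (rule fnorm_mult_right_le[OF G(1) W])
      (use one_plus_gram_le[OF A a A_le At_le] G(2) in auto)
  ultimately show ?thesis by simp
qed

end

section \<open>The derivatives of U and Sigma in block form\<close>

lemma DU_carrier: "DU (r + q) r A \<in> carrier_mat (r * (r + q)) (r * q)"
  and DU_mult_vecm:
    "B \<in> carrier_mat q r \<Longrightarrow> DU (r + q) r A *\<^sub>v vecm B =
      vecm (2 \<cdot>\<^sub>m (C * Xmat (r + q) r B * C * Ipr (r + q) r))"
proof -
  let ?p = "r + q"
  let ?E = "Ipr ?p r"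
  let ?L = "transpose_mat ?E * transpose_mat C"
  have Et: "transpose_mat ?E \<in> carrier_mat r ?p" by simp
  have Ct: "transpose_mat C \<in> carrier_mat ?p ?p" using C by simp
  have L: "?L \<in> carrier_mat r ?p" using Et Ct by (rule mult_carrier_mat)
  have Lt: "transpose_mat ?L = C * ?E"
    using transpose_mult[OF Et Ct] by simp
  have K: "kron ?L C \<in> carrier_mat (r * ?p) (?p * ?p)"
    by (rule kron_carrier[OF L C])
  have DU: "DU ?p r A = 2 \<cdot>\<^sub>m (kron ?L C * Gam ?p r)"
    by (simp add: DU_def C_def)
  note KG = mult_carrier_mat[OF K Gam_carrier]
  show "DU ?p r A \<in> carrier_mat (r * ?p) (r * q)"
    unfolding DU using KG by (rule smult_carrier_mat)
  assume B: "B \<in> carrier_mat q r"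
  have vB: "vecm B \<in> carrier_vec (r * q)" using vecm_carrier[OF B] by (simp only: mult.commute)
  have XB: "Xmat ?p r B \<in> carrier_mat ?p ?p" by (rule Xmat_carrier[OF B])
  have "DU ?p r A *\<^sub>v vecm B = 2 \<cdot>\<^sub>v (kron ?L C *\<^sub>v (Gam ?p r *\<^sub>v vecm B))"
    unfolding DU smult_mat_mult_vec[OF KG vB] assoc_mult_mat_vec[OF K Gam_carrier vB] ..
  \<comment> \<open>\<open>Gam\<close> turns the direction into its skew matrix, and the Kronecker
    identity then gives the differential of the Cayley transform.\<close>
  also have "\<dots> = vecm (2 \<cdot>\<^sub>m (C * Xmat ?p r B * (C * ?E)))"
    unfolding Gam_mult_vecm[OF B] kron_mult_vecm[OF L C XB] Lt vecm_smult ..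
  also have "C * Xmat ?p r B * (C * ?E) = C * Xmat ?p r B * C * ?E"
    by (rule assoc_mult_mat[OF mult_carrier_mat[OF C XB] C Ipr_carrier, symmetric])
  finally show "DU ?p r A *\<^sub>v vecm B = vecm (2 \<cdot>\<^sub>m (C * Xmat ?p r B * C * ?E))" .
qed

lemma Ucay: "Ucay (r + q) r A = Q * Ipr (r + q) r"
  by (simp add: Ucay_def Q_def C_def)

lemma Ucay_carrier: "Ucay (r + q) r A \<in> carrier_mat (r + q) r"
  unfolding Ucay using Q(1) Ipr_carrier by (rule mult_carrier_mat)

lemma Ucay_sandwich:
  assumes N: "N \<in> carrier_mat r r"
  shows "Ucay (r + q) r A * N * transpose_mat (Ucay (r + q) r A) =
    Q * four_block_mat N (0\<^sub>m r q) (0\<^sub>m q r) (0\<^sub>m q q) * transpose_mat Q"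
proof -
  let ?E = "Ipr (r + q) r"
  have Et: "transpose_mat ?E \<in> carrier_mat r (r + q)" by simp
  have Qt: "transpose_mat Q \<in> carrier_mat (r + q) (r + q)" using Q(1) by simp
  have EN: "?E * N \<in> carrier_mat (r + q) r"
    using Ipr_carrier N by (rule mult_carrier_mat)
  have "Q * ?E * N * (transpose_mat ?E * transpose_mat Q) = Q * (?E * N * transpose_mat ?E) * transpose_mat Q"
    unfolding assoc_mult_mat[OF Q(1) Ipr_carrier N]
      assoc_mult_mat[OF mult_carrier_mat[OF Q(1) EN] Et Qt, symmetric] assoc_mult_mat[OF Q(1) EN Et] ..
  then show ?thesis
    unfolding Ucay transpose_mult[OF Q(1) Ipr_carrier] Ipr_sandwich[OF N] .
qed

text \<open>The Kronecker factor multiplies the derivative of U on the right by (U M)^T, which gives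
  Q Z Q^T with Z supported in its first block column. The factor I + K then adds the transpose, so
  the lower right block stays zero.\<close>

lemma DphiSigma_carrier:
  "DphiSigma (r + q) r A \<mu> \<in> carrier_mat ((r + q) * (r + q)) (r * q)"
  and DphiSigma_mult_vecm:
  "B \<in> carrier_mat q r \<Longrightarrow> DphiSigma (r + q) r A \<mu> *\<^sub>v vecm B =
    vecm (Q * four_block_mat
      (2 \<cdot>\<^sub>m (V B * sym_of r \<mu>) + transpose_mat (2 \<cdot>\<^sub>m (V B * sym_of r \<mu>)))
      (transpose_mat (2 \<cdot>\<^sub>m (W B * sym_of r \<mu>)))
      (2 \<cdot>\<^sub>m (W B * sym_of r \<mu>)) (0\<^sub>m q q) * transpose_mat Q)"
proof -
  let ?p = "r + q"
  let ?M = "sym_of r \<mu>"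
  let ?E = "Ipr ?p r"
  let ?U = "Ucay ?p r A"
  let ?K = "kron (?U * ?M) (1\<^sub>m ?p)"
  have UM: "?U * ?M \<in> carrier_mat ?p r" using Ucay_carrier sym_of_carrier by (rule mult_carrier_mat)
  have K: "?K \<in> carrier_mat (?p * ?p) (r * ?p)" by (rule kron_carrier[OF UM one_carrier_mat])
  have I: "1\<^sub>m (?p * ?p) + commut ?p ?p \<in> carrier_mat (?p * ?p) (?p * ?p)"
    by (rule add_carrier_mat[OF commut_carrier])
  note IK = mult_carrier_mat[OF I K]
  show "DphiSigma ?p r A \<mu> \<in> carrier_mat (?p * ?p) (r * q)"
    unfolding DphiSigma_def by (rule mult_carrier_mat[OF IK DU_carrier])
  assume B: "B \<in> carrier_mat q r"
  have vB: "vecm B \<in> carrier_vec (r * q)" using vecm_carrier[OF B] by (simp only: mult.commute)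
  note XB = Xmat_carrier[OF B]
  let ?Y = "C * Xmat ?p r B * C"
  have Y: "?Y \<in> carrier_mat ?p ?p" using C XB by simp
  have YE: "?Y * ?E \<in> carrier_mat ?p r" using Y Ipr_carrier by (rule mult_carrier_mat)
  have vYE: "vecm (2 \<cdot>\<^sub>m (?Y * ?E)) \<in> carrier_vec (r * ?p)"
    using vecm_carrier[OF smult_carrier_mat[OF YE]] by (simp only: mult.commute)
  have Et: "transpose_mat ?E \<in> carrier_mat r ?p" by simp
  have Qt: "transpose_mat Q \<in> carrier_mat ?p ?p" using Q(1) by simp
  have UMt: "transpose_mat (?U * ?M) = ?M * transpose_mat ?E * transpose_mat Q"
    unfolding transpose_mult[OF Ucay_carrier sym_of_carrier] sym_of_symmetric
    unfolding Ucay transpose_mult[OF Q(1) Ipr_carrier]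
    by (rule assoc_mult_mat[OF sym_of_carrier Et Qt, symmetric])
  let ?F = "four_block_mat ?M (0\<^sub>m r q) (0\<^sub>m q r) (0\<^sub>m q q)"
  let ?N = "transpose_mat C * Xmat ?p r B * C"
  have N: "?N \<in> carrier_mat ?p ?p" using C XB by simp
  have F: "?F \<in> carrier_mat ?p ?p" by (rule four_block_carrier_mat[OF sym_of_carrier zero_carrier_mat])
  have MEt: "?M * transpose_mat ?E \<in> carrier_mat r ?p" using sym_of_carrier Et by (rule mult_carrier_mat)
  obtain V12 V22 where V2: "V12 \<in> carrier_mat r q" "V22 \<in> carrier_mat q q"
    and NV: "?N = four_block_mat (V B) V12 (W B) V22"
    using conjugated_direction[OF B] .
  note VW = V_W_carrier[OF B]
  let ?VM = "2 \<cdot>\<^sub>m (V B * ?M)" and ?WM = "2 \<cdot>\<^sub>m (W B * ?M)"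
  have VM: "?VM \<in> carrier_mat r r" and WM: "?WM \<in> carrier_mat q r" using VW by auto
  let ?Z = "four_block_mat ?VM (0\<^sub>m r q) ?WM (0\<^sub>m q q)"
  have Z: "?Z \<in> carrier_mat ?p ?p" by (rule four_block_carrier_mat[OF VM zero_carrier_mat])
  \<comment> \<open>Only the first block column of the conjugated direction survives the product
    with diag(M, 0).\<close>
  have NF: "2 \<cdot>\<^sub>m (?N * ?F) = ?Z"
  proof -
    have "?N * ?F = four_block_mat (V B * ?M) (0\<^sub>m r q) (W B * ?M) (0\<^sub>m q q)"
      unfolding NV mult_four_block_mat[OF VW(1) V2(1) VW(2) V2(2) sym_of_carrier zero_carrier_mat
          zero_carrier_mat zero_carrier_mat]
      using VW V2 by simp
    then show ?thesis
      using VW by (simp add: smult_four_block_mat[of _ r r _ q _ q])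
  qed
  \<comment> \<open>Trades the leading \<open>C\<close> for Q C^T, so that the whole derivative
    becomes a conjugation by \<open>Q\<close>.\<close>
  have QN: "Q * ?N = ?Y"
    unfolding Q_def by (rule cayley_orthogonal(2)[OF X Xmat_skew[OF A] C C_block(2,3) XB])
  have "2 \<cdot>\<^sub>m (?Y * ?E) * transpose_mat (?U * ?M) = 2 \<cdot>\<^sub>m (?Y * ?E * (?M * transpose_mat ?E * transpose_mat Q))"
    unfolding UMt by (rule mult_smult_assoc_mat[OF YE mult_carrier_mat[OF MEt Qt]])
  also have "?Y * ?E * (?M * transpose_mat ?E * transpose_mat Q) = ?Y * (?E * ?M * transpose_mat ?E) * transpose_mat Q"
    unfolding assoc_mult_mat[OF YE MEt Qt, symmetric] assoc_mult_mat[OF Y Ipr_carrier MEt]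
      assoc_mult_mat[OF Ipr_carrier sym_of_carrier Et, symmetric] ..
  also have "\<dots> = Q * (?N * ?F) * transpose_mat Q"
    unfolding Ipr_sandwich[OF sym_of_carrier] QN[symmetric]
    by (simp only: assoc_mult_mat[OF Q(1) N F])
  also have "2 \<cdot>\<^sub>m \<dots> = Q * ?Z * transpose_mat Q"
  proof -
    have NFc: "?N * ?F \<in> carrier_mat ?p ?p" using N F by (rule mult_carrier_mat)
    show ?thesis
      unfolding NF[symmetric] mult_smult_distrib[OF Q(1) NFc]
      by (rule mult_smult_assoc_mat[OF mult_carrier_mat[OF Q(1) NFc] Qt, symmetric])
  qed
  finally have main: "2 \<cdot>\<^sub>m (?Y * ?E) * transpose_mat (?U * ?M) = Q * ?Z * transpose_mat Q" .
  have QZ: "Q * ?Z \<in> carrier_mat ?p ?p" using Q(1) Z by (rule mult_carrier_mat)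
  have QZQ: "Q * ?Z * transpose_mat Q \<in> carrier_mat ?p ?p" using QZ Qt by (rule mult_carrier_mat)
  have Zt: "transpose_mat ?Z \<in> carrier_mat ?p ?p" using Z by simp
  have "DphiSigma ?p r A \<mu> *\<^sub>v vecm B =
      (1\<^sub>m (?p * ?p) + commut ?p ?p) *\<^sub>v (?K *\<^sub>v vecm (2 \<cdot>\<^sub>m (?Y * ?E)))"
    unfolding DphiSigma_def assoc_mult_mat_vec[OF IK DU_carrier vB] DU_mult_vecm[OF B]
    by (rule assoc_mult_mat_vec[OF I K vYE])
  also have "?K *\<^sub>v vecm (2 \<cdot>\<^sub>m (?Y * ?E)) = vecm (Q * ?Z * transpose_mat Q)"
    unfolding kron_mult_vecm[OF UM one_carrier_mat smult_carrier_mat[OF YE]]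
      left_mult_one_mat[OF smult_carrier_mat[OF YE]] main ..
  also have "(1\<^sub>m (?p * ?p) + commut ?p ?p) *\<^sub>v \<dots> =
      vecm (Q * ?Z * transpose_mat Q + transpose_mat (Q * ?Z * transpose_mat Q))"
    by (rule one_plus_commut_mult_vecm[OF QZQ])
  also have "transpose_mat (Q * ?Z * transpose_mat Q) = Q * transpose_mat ?Z * transpose_mat Q"
    unfolding transpose_mult[OF QZ Qt] transpose_mult[OF Q(1) Z] transpose_transpose
    by (rule assoc_mult_mat[OF Q(1) Zt Qt, symmetric])
  also have "Q * ?Z * transpose_mat Q + Q * transpose_mat ?Z * transpose_mat Q =
      Q * (?Z + transpose_mat ?Z) * transpose_mat Q"
    unfolding mult_add_distrib_mat[OF Q(1) Z Zt]
    by (rule add_mult_distrib_mat[OF QZ mult_carrier_mat[OF Q(1) Zt] Qt, symmetric])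
  also have "?Z + transpose_mat ?Z =
      four_block_mat (?VM + transpose_mat ?VM) (transpose_mat ?WM) ?WM (0\<^sub>m q q)"
  proof -
    have t: "transpose_mat ?Z = four_block_mat (transpose_mat ?VM) (transpose_mat ?WM) (0\<^sub>m q r) (0\<^sub>m q q)"
      unfolding transpose_four_block_mat[OF VM zero_carrier_mat WM zero_carrier_mat] by simp
    have VMt: "transpose_mat ?VM \<in> carrier_mat r r" and WMt: "transpose_mat ?WM \<in> carrier_mat r q"
      using VM WM by simp_all
    show ?thesis
      unfolding t add_four_block_mat[OF VM zero_carrier_mat WM zero_carrier_mat VMt WMt
          zero_carrier_mat zero_carrier_mat]
        left_add_zero_mat[OF WMt] right_add_zero_mat[OF WM] by simp
  qed
  finally show "DphiSigma ?p r A \<mu> *\<^sub>v vecm B = vecm (Q * four_block_mat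
      (?VM + transpose_mat ?VM) (transpose_mat ?WM) ?WM (0\<^sub>m q q) * transpose_mat Q)" .
qed

lemma DmuSigma_carrier:
  "DmuSigma (r + q) r A \<in> carrier_mat ((r + q) * (r + q)) (r * (r + 1) div 2)"
  unfolding DmuSigma_def
  by (rule mult_carrier_mat[OF kron_carrier[OF Ucay_carrier Ucay_carrier] dup_carrier])

lemma DmuSigma_mult:
  assumes w: "w \<in> carrier_vec (r * (r + 1) div 2)"
  shows "DmuSigma (r + q) r A *\<^sub>v w =
    vecm (Q * four_block_mat (sym_of r w) (0\<^sub>m r q) (0\<^sub>m q r) (0\<^sub>m q q) * transpose_mat Q)"
  unfolding DmuSigma_def assoc_mult_mat_vec[OF kron_carrier[OF Ucay_carrier Ucay_carrier] dup_carrier w]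
    dup_mult_vec[OF w] kron_mult_vecm[OF Ucay_carrier Ucay_carrier sym_of_carrier]
    Ucay_sandwich[OF sym_of_carrier] ..

lemma DSigma_carrier:
  "DSigma (r + q) r A \<mu> \<in> carrier_mat ((r + q) * (r + q)) (r * q + r * (r + 1) div 2)"
  unfolding DSigma_def by (rule hcat_carrier[OF DphiSigma_carrier DmuSigma_carrier])

text \<open>Conjugation by the orthogonal \<open>Q\<close> preserves the Frobenius norm, so the
  squared norms of the blocks add up. The vector \<open>w\<close> enters the leading block only; the
  8 counts two off-diagonal blocks, each with the square of the factor 2.\<close>

lemma vnorm_DSigma_sq:
  assumes B: "B \<in> carrier_mat q r" and w: "w \<in> carrier_vec (r * (r + 1) div 2)"
  shows "(vnorm (DSigma (r + q) r A \<mu> *\<^sub>v (vecm B @\<^sub>v w)))\<^sup>2 =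
    (fnorm (2 \<cdot>\<^sub>m (V B * sym_of r \<mu>) + transpose_mat (2 \<cdot>\<^sub>m (V B * sym_of r \<mu>)) + sym_of r w))\<^sup>2
    + 8 * (fnorm (W B * sym_of r \<mu>))\<^sup>2"
proof -
  let ?VM = "2 \<cdot>\<^sub>m (V B * sym_of r \<mu>)" and ?WM = "2 \<cdot>\<^sub>m (W B * sym_of r \<mu>)"
  note VW = V_W_carrier[OF B]
  have VM: "?VM \<in> carrier_mat r r" and WM: "?WM \<in> carrier_mat q r" using VW by auto
  have VM2: "?VM + transpose_mat ?VM \<in> carrier_mat r r" and WMt: "transpose_mat ?WM \<in> carrier_mat r q"
    using VM WM by simp_all
  let ?Z = "four_block_mat (?VM + transpose_mat ?VM) (transpose_mat ?WM) ?WM (0\<^sub>m q q)"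
  let ?N = "four_block_mat (sym_of r w) (0\<^sub>m r q) (0\<^sub>m q r) (0\<^sub>m q q)"
  have Z: "?Z \<in> carrier_mat (r + q) (r + q)" by (rule four_block_carrier_mat[OF VM2 zero_carrier_mat])
  have N: "?N \<in> carrier_mat (r + q) (r + q)"
    by (rule four_block_carrier_mat[OF sym_of_carrier zero_carrier_mat])
  have Qt: "transpose_mat Q \<in> carrier_mat (r + q) (r + q)" using Q(1) by simp
  note QZ = mult_carrier_mat[OF Q(1) Z] and QN = mult_carrier_mat[OF Q(1) N]
  have vB: "vecm B \<in> carrier_vec (r * q)" using vecm_carrier[OF B] by (simp only: mult.commute)
  have sum: "?Z + ?N = four_block_mat (?VM + transpose_mat ?VM + sym_of r w) (transpose_mat ?WM) ?WM (0\<^sub>m q q)"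
    unfolding add_four_block_mat[OF VM2 WMt WM zero_carrier_mat sym_of_carrier zero_carrier_mat
        zero_carrier_mat zero_carrier_mat] right_add_zero_mat[OF WM] right_add_zero_mat[OF WMt] by simp
  have "DSigma (r + q) r A \<mu> *\<^sub>v (vecm B @\<^sub>v w) =
      vecm (Q * ?Z * transpose_mat Q) + vecm (Q * ?N * transpose_mat Q)"
    unfolding DSigma_def hcat_mult_append[OF DphiSigma_carrier DmuSigma_carrier vB w]
      DphiSigma_mult_vecm[OF B] DmuSigma_mult[OF w] ..
  also have "\<dots> = vecm (Q * (?Z + ?N) * transpose_mat Q)"
    unfolding mult_add_distrib_mat[OF Q(1) Z N] add_mult_distrib_mat[OF QZ QN Qt]
    by (rule vecm_add[symmetric, OF mult_carrier_mat[OF QZ Qt] mult_carrier_mat[OF QN Qt]])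
  finally have "vnorm (DSigma (r + q) r A \<mu> *\<^sub>v (vecm B @\<^sub>v w)) = fnorm (?Z + ?N)"
    using fnorm_isometry[OF Q add_carrier_mat[OF N, of ?Z]] by (simp add: fnorm_def)
  moreover have "(fnorm (?Z + ?N))\<^sup>2 = (fnorm (?VM + transpose_mat ?VM + sym_of r w))\<^sup>2 + 8 * (fnorm (W B * sym_of r \<mu>))\<^sup>2"
  proof -
    have "fnorm (0\<^sub>m q q) = 0"
      using fnorm_sq[of "0\<^sub>m q q" q q] by simp
    then show ?thesis
      unfolding sum fnorm_four_block_sq[OF add_carrier_mat[OF sym_of_carrier] WMt WM zero_carrier_mat]
        fnorm_transpose fnorm_smult by (simp add: power_mult_distrib)
  qed
  ultimately show ?thesis by simp
qed

text \<open>The case \<open>w = 0\<close> of the block identity with the leading block dropped: the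
  off-diagonal blocks alone control the direction.\<close>

lemma vnorm_DphiSigma_ge:
  assumes B: "B \<in> carrier_mat q r" and s: "0 \<le> s"
    and M_ge: "\<And>x. x \<in> carrier_vec r \<Longrightarrow> s * vnorm x \<le> vnorm (sym_of r \<mu> *\<^sub>v x)"
  shows "sqrt 8 * s * fnorm (W B) \<le> vnorm (DphiSigma (r + q) r A \<mu> *\<^sub>v vecm B)"
proof -
  let ?n = "r * (r + 1) div 2"
  have vB: "vecm B \<in> carrier_vec (r * q)" using vecm_carrier[OF B] by (simp only: mult.commute)
  have "DmuSigma (r + q) r A *\<^sub>v 0\<^sub>v ?n = 0\<^sub>v ((r + q) * (r + q))"
    using DmuSigma_carrier by (intro eq_vecI) auto
  then have "DSigma (r + q) r A \<mu> *\<^sub>v (vecm B @\<^sub>v 0\<^sub>v ?n) = DphiSigma (r + q) r A \<mu> *\<^sub>v vecm B"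
    unfolding DSigma_def hcat_mult_append[OF DphiSigma_carrier DmuSigma_carrier vB zero_carrier_vec]
    using DphiSigma_carrier[of \<mu>] vB by simp
  then have "8 * (fnorm (W B * sym_of r \<mu>))\<^sup>2 \<le> (vnorm (DphiSigma (r + q) r A \<mu> *\<^sub>v vecm B))\<^sup>2"
    using vnorm_DSigma_sq[OF B zero_carrier_vec, of \<mu>] by simp
  moreover have "s * fnorm (W B) \<le> fnorm (W B * sym_of r \<mu>)"
    by (rule fnorm_mult_right_ge[OF sym_of_carrier V_W_carrier(2)[OF B] s])
      (use M_ge sym_of_symmetric in auto)
  then have "(s * fnorm (W B))\<^sup>2 \<le> (fnorm (W B * sym_of r \<mu>))\<^sup>2"
    using s by (intro power_mono) auto
  ultimately have "(sqrt 8 * s * fnorm (W B))\<^sup>2 \<le> (vnorm (DphiSigma (r + q) r A \<mu> *\<^sub>v vecm B))\<^sup>2"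
    by (simp add: power_mult_distrib)
  then show ?thesis by (rule power2_le_imp_le) simp
qed

text \<open>Recovers the symmetric part by subtracting the contribution of \<open>B\<close> from the
  leading block. The 8 is a product of three factors 2: from the derivative, from adding the
  transpose, and from \<open>fnorm_V_le\<close>.\<close>

lemma fnorm_sym_of_le:
  assumes B: "B \<in> carrier_mat q r" and m: "0 \<le> m"
    and a: "0 \<le> a" "a \<le> 1"
    and At_le: "\<And>y. y \<in> carrier_vec q \<Longrightarrow> vnorm (transpose_mat A *\<^sub>v y) \<le> a * vnorm y"
    and M_le: "\<And>x. x \<in> carrier_vec r \<Longrightarrow> vnorm (sym_of r \<mu> *\<^sub>v x) \<le> m * vnorm x"
  shows "fnorm (sym_of r w) \<le>
    fnorm (2 \<cdot>\<^sub>m (V B * sym_of r \<mu>) + transpose_mat (2 \<cdot>\<^sub>m (V B * sym_of r \<mu>)) + sym_of r w)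
    + 8 * m * fnorm B"
proof -
  let ?VM = "2 \<cdot>\<^sub>m (V B * sym_of r \<mu>)"
  let ?E = "?VM + transpose_mat ?VM"
  note VW = V_W_carrier[OF B]
  have VM: "?VM \<in> carrier_mat r r" using VW by auto
  have E: "?E \<in> carrier_mat r r" using VM by simp
  have "fnorm (V B * sym_of r \<mu>) \<le> m * fnorm (V B)"
    by (rule fnorm_mult_right_le[OF sym_of_carrier VW(1) m]) (use M_le sym_of_symmetric in auto)
  also have "\<dots> \<le> m * (2 * fnorm B)"
    by (rule mult_left_mono[OF fnorm_V_le[OF B a At_le] m])
  finally have "fnorm ?VM \<le> 4 * m * fnorm B" by (simp add: fnorm_smult)
  moreover have "fnorm ?E \<le> fnorm ?VM + fnorm (transpose_mat ?VM)"
    using VM by (intro fnorm_triangle) auto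
  ultimately have E_le: "fnorm ?E \<le> 8 * m * fnorm B" unfolding fnorm_transpose by simp
  have "fnorm (sym_of r w) \<le> fnorm (?E + sym_of r w) + fnorm ?E"
    using fnorm_diff_triangle[OF add_carrier_mat[OF sym_of_carrier, of ?E] E, of w]
    unfolding add_diff_cancel_mat(2)[OF sym_of_carrier E] .
  with E_le show ?thesis by simp
qed

end

section \<open>The bounds\<close>

text \<open>The block-triangular structure in numbers: \<open>x\<close> (off-diagonal blocks)
  controls \<open>b\<close> (the direction), and \<open>y\<close> (leading block) controls
  \<open>\<nu>\<close> (the symmetric part) up to a multiple of \<open>b\<close>.\<close>

lemma triangular_bound:
  fixes b y x c s \<nu> :: real
  assumes s: "0 < s" and bx: "s * b \<le> x" and \<nu>y: "\<nu> \<le> y + c * b"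
    and nonneg: "0 \<le> b" "0 \<le> \<nu>" "0 \<le> y" "0 \<le> c"
  shows "b\<^sup>2 + \<nu>\<^sup>2 \<le> (1 + (1 + c\<^sup>2) / s\<^sup>2) * (x\<^sup>2 + y\<^sup>2)"
proof -
  define z where "z = x / s"
  have z: "b \<le> z" using bx s by (simp add: z_def field_simps)
  have x: "x = s * z" using s by (simp add: z_def)
  have "\<nu> \<le> y + c * z" using \<nu>y z nonneg(4) mult_left_mono[OF z nonneg(4)] by linarith
  then have "\<nu>\<^sup>2 \<le> (y + c * z)\<^sup>2" using nonneg by (intro power_mono) auto
  \<comment> \<open>The added square is chosen so that its cross term cancels the one of the first
    square.\<close>
  also have "\<dots> \<le> (y + c * z)\<^sup>2 + (s * z - c / s * y)\<^sup>2" by simp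
  also have "\<dots> = y\<^sup>2 + (c * z)\<^sup>2 + x\<^sup>2 + (c / s)\<^sup>2 * y\<^sup>2"
    using s by (simp add: x power2_eq_square field_simps)
  finally have \<nu>: "\<nu>\<^sup>2 \<le> y\<^sup>2 + (c * z)\<^sup>2 + x\<^sup>2 + (c / s)\<^sup>2 * y\<^sup>2" .
  have b: "b\<^sup>2 \<le> z\<^sup>2" using z nonneg by (intro power_mono) auto
  have "(1 + (1 + c\<^sup>2) / s\<^sup>2) * (x\<^sup>2 + y\<^sup>2) =
      (y\<^sup>2 + (c * z)\<^sup>2 + x\<^sup>2 + (c / s)\<^sup>2 * y\<^sup>2) + z\<^sup>2 + y\<^sup>2 / s\<^sup>2"
    using s by (simp add: x power2_eq_square field_simps)
  moreover have "0 \<le> y\<^sup>2 / s\<^sup>2" by simp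
  ultimately show ?thesis using \<nu> b by linarith
qed

text \<open>With G the Gram matrix, |x|^2 <= K x . Gx <= K |x| |Gx|. Hence G stretches by at least
  1/K, and its inverse by at most K.\<close>

lemma gram_inverse_bound:
  fixes D :: "real mat"
  assumes D: "D \<in> carrier_mat m n" and n: "0 < n" and K: "0 < K"
    and ge: "\<And>x. x \<in> carrier_vec n \<Longrightarrow> (vnorm x)\<^sup>2 \<le> K * (vnorm (D *\<^sub>v x))\<^sup>2"
  shows "invertible_mat (transpose_mat D * D)" "spec_norm (minv (transpose_mat D * D)) \<le> K"
proof -
  let ?G = "transpose_mat D * D"
  note G = gram_carrier(1)[OF D]
  have Gge: "vnorm x \<le> K * vnorm (?G *\<^sub>v x)" if x: "x \<in> carrier_vec n" for x
  proof -
    have "(vnorm x)\<^sup>2 \<le> K * (x \<bullet> (?G *\<^sub>v x))"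
      using ge[OF x] unfolding vnorm_mult_sq[OF D x] .
    also have "\<dots> \<le> K * (vnorm x * vnorm (?G *\<^sub>v x))"
      using K x G by (intro mult_left_mono scalar_prod_le_vnorm[of _ n]) auto
    finally have "vnorm x * vnorm x \<le> vnorm x * (K * vnorm (?G *\<^sub>v x))"
      by (simp add: power2_eq_square algebra_simps)
    moreover have "0 \<le> K * vnorm (?G *\<^sub>v x)" using K by simp
    ultimately show ?thesis
      by (metis mult_le_cancel_left vnorm_nonneg order_le_less)
  qed
  have exp: "1 / K * vnorm x \<le> vnorm (?G *\<^sub>v x)" if "x \<in> carrier_vec n" for x
    using Gge[OF that] K by (simp add: field_simps)
  have K': "0 < 1 / K" using K by simp
  note H = expansive_inverse[OF G K' exp]
  show "invertible_mat ?G" by (rule H(4))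
  show "spec_norm (minv ?G) \<le> K"
  proof (rule spec_norm_leI[OF H(1) n])
    fix x :: "real vec" assume x: "x \<in> carrier_vec n"
    have "minv ?G *\<^sub>v x \<in> carrier_vec n" using H(1) x by simp
    from Gge[OF this] have "vnorm (minv ?G *\<^sub>v x) \<le> K * vnorm (?G *\<^sub>v (minv ?G *\<^sub>v x))" .
    also have "?G *\<^sub>v (minv ?G *\<^sub>v x) = x"
      using assoc_mult_mat_vec[OF G H(1) x] H(2) x by simp
    finally show "vnorm (minv ?G *\<^sub>v x) \<le> K * vnorm x" .
  qed
qed

text \<open>The guard \<open>r < p\<close> belongs to the first bound alone: for
  \<open>r = p\<close> the matrix \<open>DphiSigma\<close> has no columns, its Gram matrix has no
  eigenvalues, and \<open>sigma_min\<close> would refer to the minimum of the empty set.\<close>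

theorem theorem6:
  fixes p r :: nat and A0 :: "real mat" and \<mu>0 :: "real vec"
  assumes "1 \<le> r" and "r \<le> p"
    and "A0 \<in> carrier_mat (p - r) r" and "spec_norm A0 < 1"
    and "\<mu>0 \<in> carrier_vec (r * (r + 1) div 2)"
    and "invertible_mat (sym_of r \<mu>0)"
  shows
    "(r < p \<longrightarrow>
        sigma_min (DphiSigma p r A0 \<mu>0) \<ge>
          (if r \<ge> 2
           then 2 * sqrt 2 * sigma_min (sym_of r \<mu>0) * (1 - (spec_norm A0)\<^sup>2) / (1 + (spec_norm A0)\<^sup>2)\<^sup>2
           else 2 * sqrt 2 * sigma_min (sym_of r \<mu>0) / (1 + (spec_norm A0)\<^sup>2)))
     \<and> invertible_mat (transpose_mat (DSigma p r A0 \<mu>0) * DSigma p r A0 \<mu>0)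
     \<and> spec_norm (minv (transpose_mat (DSigma p r A0 \<mu>0) * DSigma p r A0 \<mu>0)) \<le>
          (if r \<ge> 2
           then 1 + (1 + 64 * (spec_norm (sym_of r \<mu>0))\<^sup>2) * (1 + (spec_norm A0)\<^sup>2) ^ 4
                    / (8 * (eig_min_abs (sym_of r \<mu>0))\<^sup>2 * (1 - (spec_norm A0)\<^sup>2)\<^sup>2)
           else 1 + (1 + 64 * (spec_norm (sym_of r \<mu>0))\<^sup>2) * (1 + (spec_norm A0)\<^sup>2)\<^sup>2
                    / (8 * (eig_min_abs (sym_of r \<mu>0))\<^sup>2))"
proof -
  define q where "q = p - r"
  have p: "p = r + q" using assms(2) by (simp add: q_def)
  have A: "A0 \<in> carrier_mat q r" using assms(3) by (simp add: q_def)
  have r: "0 < r" using assms(1) by simp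
  interpret cayley_point r q A0 by unfold_locales (rule A)
  let ?M = "sym_of r \<mu>0"
  define a where "a = spec_norm A0"
  define \<sigma> where "\<sigma> = sigma_min ?M"
  define e where "e = eig_min_abs ?M"
  define m where "m = spec_norm ?M"
  \<comment> \<open>A lower stretching factor of the map from \<open>B\<close> to
    \<open>W B\<close>, taken from \<open>fnorm_W_ge_general\<close> or, for a single column, from
    \<open>fnorm_W_ge_column\<close>.\<close>
  define k where "k = (if r \<ge> 2 then (1 - a\<^sup>2) / (1 + a\<^sup>2)\<^sup>2 else 1 / (1 + a\<^sup>2))"
  let ?D = "DSigma p r A0 \<mu>0"
  have a: "0 \<le> a" "a < 1" using spec_norm_nonneg[OF A r] assms(4) by (auto simp: a_def)
  have a2: "a\<^sup>2 < 1" using a by (simp add: power_less_one_iff)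
  have pos: "0 < 1 + a\<^sup>2" by (simp add: add_pos_nonneg)
  have k: "0 < k" using a2 pos by (simp add: k_def)
  have A_le: "vnorm (A0 *\<^sub>v x) \<le> a * vnorm x" if "x \<in> carrier_vec r" for x
    unfolding a_def by (rule spec_norm_mult_ge[OF A r that])
  have At_le: "vnorm (transpose_mat A0 *\<^sub>v y) \<le> a * vnorm y" if "y \<in> carrier_vec q" for y
    unfolding a_def by (rule spec_norm_transpose_mult_ge[OF A r that])
  have \<sigma>: "0 \<le> \<sigma>" unfolding \<sigma>_def by (rule sigma_min_nonneg[OF sym_of_carrier r])
  have e: "0 < e" "e \<le> \<sigma>"
    unfolding e_def \<sigma>_def using eig_min_abs_pos[OF sym_of_carrier sym_of_symmetric r assms(6)]
      eig_min_abs_le_sigma_min[OF sym_of_carrier sym_of_symmetric r] by auto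
  have m: "0 \<le> m" unfolding m_def by (rule spec_norm_nonneg[OF sym_of_carrier r])
  have M_ge: "\<sigma> * vnorm x \<le> vnorm (?M *\<^sub>v x)" if "x \<in> carrier_vec r" for x
    unfolding \<sigma>_def by (rule sigma_min_mult_le[OF sym_of_carrier r that])
  have M_le: "vnorm (?M *\<^sub>v x) \<le> m * vnorm x" if "x \<in> carrier_vec r" for x
    unfolding m_def by (rule spec_norm_mult_ge[OF sym_of_carrier r that])
  have W_ge: "k * fnorm B \<le> fnorm (W B)" if B: "B \<in> carrier_mat q r" for B
  proof (cases "r \<ge> 2")
    case True
    then show ?thesis
      using fnorm_W_ge_general[OF a(1) A_le At_le B] pos by (simp add: k_def field_simps)
  next
    case False
    then have "r = 1" using r by simp
    then show ?thesis
      using fnorm_W_ge_column[OF a(1) A_le At_le B] pos by (simp add: k_def field_simps)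
  qed
  have sqrt8: "sqrt 8 = 2 * sqrt 2"
    using real_sqrt_mult[of 4 2] by simp
  have part1: "sqrt 8 * \<sigma> * k \<le> sigma_min (DphiSigma p r A0 \<mu>0)" if "r < p"
  proof (rule sigma_min_geI)
    show "DphiSigma p r A0 \<mu>0 \<in> carrier_mat (p * p) (r * q)"
      unfolding p by (rule DphiSigma_carrier)
    show "0 < r * q" using that r by (simp add: q_def)
    fix x :: "real vec" assume "x \<in> carrier_vec (r * q)"
    then obtain B where B: "B \<in> carrier_mat q r" "vecm B = x"
      using vecm_surj[of x q r] by (auto simp: mult.commute)
    have "sqrt 8 * \<sigma> * k * vnorm x = sqrt 8 * \<sigma> * (k * fnorm B)"
      by (simp add: fnorm_def B(2))
    also have "\<dots> \<le> sqrt 8 * \<sigma> * fnorm (W B)"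
      using \<sigma> by (intro mult_left_mono W_ge B) auto
    also have "\<dots> \<le> vnorm (DphiSigma p r A0 \<mu>0 *\<^sub>v x)"
      unfolding p B(2)[symmetric] by (rule vnorm_DphiSigma_ge[OF B(1) \<sigma> M_ge])
    finally show "sqrt 8 * \<sigma> * k * vnorm x \<le> vnorm (DphiSigma p r A0 \<mu>0 *\<^sub>v x)" .
  qed
  \<comment> \<open>The bound on the inverse is stated with |lambda_r|, so \<open>e\<close> replaces
    the possibly larger \<open>\<sigma>\<close>. The constant \<open>K\<close> below is that of
    \<open>triangular_bound\<close> for \<open>c = 8 * m\<close>, whence the 64.\<close>
  define s where "s = sqrt 8 * e * k"
  define K where "K = 1 + (1 + (8 * m)\<^sup>2) / s\<^sup>2"
  have s: "0 < s" using e k by (simp add: s_def)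
  have K: "0 < K" by (simp add: K_def add_pos_nonneg)
  let ?n = "r * (r + 1) div 2"
  have D: "?D \<in> carrier_mat (p * p) (r * q + ?n)" unfolding p by (rule DSigma_carrier)
  \<comment> \<open>For \<open>q = 0\<close> only the half-vectorized coordinates remain; there is
    at least one because \<open>r\<close> is positive.\<close>
  have n: "0 < r * q + ?n"
  proof -
    have "2 \<le> r * (r + 1)" using mult_le_mono[of 1 r 2 "r + 1"] r by simp
    then show ?thesis by (simp add: div_greater_zero_iff)
  qed
  have D_ge: "(vnorm x)\<^sup>2 \<le> K * (vnorm (?D *\<^sub>v x))\<^sup>2" if x: "x \<in> carrier_vec (r * q + ?n)" for x
  proof -
    \<comment> \<open>The argument splits into a vectorized direction and the half-vectorization of
      a symmetric matrix.\<close>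
    define v where "v = vec_first x (r * q)"
    define w where "w = vec_last x ?n"
    have v: "v \<in> carrier_vec (r * q)" and w: "w \<in> carrier_vec ?n" by (simp_all add: v_def w_def)
    have xvw: "x = v @\<^sub>v w" unfolding v_def w_def using x by simp
    obtain B where B: "B \<in> carrier_mat q r" "vecm B = v"
      using vecm_surj[of v q r] v by (auto simp: mult.commute)
    let ?y = "fnorm (2 \<cdot>\<^sub>m (V B * ?M) + transpose_mat (2 \<cdot>\<^sub>m (V B * ?M)) + sym_of r w)"
    let ?x = "sqrt 8 * fnorm (W B * ?M)"
    have "e * (k * fnorm B) \<le> \<sigma> * fnorm (W B)"
      using e k \<sigma> by (intro mult_mono W_ge B) auto
    also have "\<dots> \<le> fnorm (W B * ?M)"
      by (rule fnorm_mult_right_ge[OF sym_of_carrier V_W_carrier(2)[OF B(1)] \<sigma>])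
        (use M_ge sym_of_symmetric in auto)
    finally have "s * fnorm B \<le> ?x" by (simp add: s_def mult.assoc)
    moreover have "vnorm w \<le> ?y + 8 * m * fnorm B"
      using vnorm_le_fnorm_sym_of[OF w]
        fnorm_sym_of_le[OF B(1) m a(1) less_imp_le[OF a(2)] At_le M_le, of w] by linarith
    ultimately have "(fnorm B)\<^sup>2 + (vnorm w)\<^sup>2 \<le> K * (?x\<^sup>2 + ?y\<^sup>2)"
      unfolding K_def using s m by (intro triangular_bound) auto
    moreover have "(vnorm x)\<^sup>2 = (fnorm B)\<^sup>2 + (vnorm w)\<^sup>2"
      by (simp add: xvw vnorm_append_sq fnorm_def B(2))
    moreover have "(vnorm (?D *\<^sub>v x))\<^sup>2 = ?x\<^sup>2 + ?y\<^sup>2"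
      unfolding p xvw B(2)[symmetric] vnorm_DSigma_sq[OF B(1) w] by (simp add: power_mult_distrib)
    ultimately show ?thesis by simp
  qed
  note part2 = gram_inverse_bound[OF D n K D_ge]
  \<comment> \<open>Squaring \<open>s\<close> produces the 8 and the square of \<open>e\<close>, and
    squaring \<open>k\<close> gives the fourth or second power of \<open>1 + a^2\<close>.\<close>
  have "K = (if r \<ge> 2
           then 1 + (1 + 64 * m\<^sup>2) * (1 + a\<^sup>2) ^ 4 / (8 * e\<^sup>2 * (1 - a\<^sup>2)\<^sup>2)
           else 1 + (1 + 64 * m\<^sup>2) * (1 + a\<^sup>2)\<^sup>2 / (8 * e\<^sup>2))"
    by (simp add: K_def s_def k_def power_mult_distrib power_divide flip: power_mult)
  moreover have "sqrt 8 * \<sigma> * k = (if r \<ge> 2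
           then 2 * sqrt 2 * \<sigma> * (1 - a\<^sup>2) / (1 + a\<^sup>2)\<^sup>2 else 2 * sqrt 2 * \<sigma> / (1 + a\<^sup>2))"
    unfolding sqrt8 by (simp add: k_def)
  ultimately show ?thesis
    using part1 part2 unfolding a_def[symmetric] \<sigma>_def[symmetric] e_def[symmetric] m_def[symmetric]
    by simp
qed

end
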